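(* Consider the binary additive noisy multiple access channel with noiseless feedback, $Y=X_1+X_2+N$, where $X_1,X_2\in\{0,1\}$, addition is ordinary integer addition, and $N$ is uniform on $\{0,1\}$ and independent of $(X_1,X_2)$. There is a unique pair $(u_1^*,u_2^* )\in[0,\frac14]^2$ with $$h(\phi(2u_1^* ))=\tfrac12h(\phi(2u_2^* ))=\tfrac12h\Bigl(\tfrac{1-f(2u_1^*,2u_2^* )}{2}\Bigr),$$ and, with $R^*$ denoting this common value, $$R^*=\max_{u_1,u_2\in[0,\frac14]}\min\Bigl(h(\phi(2u_1)),\ \tfrac12h(\phi(2u_2)),\ \tfrac12h\bigl(\tfrac{1-f(2u_1,2u_2)}{2}\bigr)\Bigr).$$ Numerically $u_1^*\approx0.086063$, $u_2^*\approx0.218333$ and $R^*\approx0.45330$. Every $R$ such that $(R,R)$ lies in the capacity region of the channel satisfies $R\le R^*$. Moreover, $R^*$ equals the largest $R$ for which there is a distribution $p(t)p(x_1|t)p(x_2|t)$, with $T$ taking at most $7$ values, satisfying $$R\le\min\bigl(I(X_1;Y|X_2),H(X_1|T)\bigr),\quad R\le\tfrac12H(X_2|T),\quad 2R\le I(X_1,X_2;Y),$$ and $R=R^*$ is attained in these constraints by a binary $T$ uniform on $\{0,1\}$, with $\Pr(X_1=0|T=0)=1-\Pr(X_1=0|T=1)=\phi(2u_1^* )$ and $\Pr(X_2=0|T=0)=1-\Pr(X_2=0|T=1)=\phi(2u_2^* )$.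
   Context: All logarithms, entropies and mutual informations are to base 2. $h(s)=-s\log s-(1-s)\log(1-s)$ is the binary entropy function on $[0,1]$ (with $0\log0=0$). The function $\phi:[0,1]\to[0,\frac12]$ is $\phi(s)=\frac{1-\sqrt{1-2s}}{2}$ for $0\le s\le\frac12$ and $\phi(s)=\frac{1-\sqrt{2s-1}}{2}$ for $\frac12<s\le1$. For $x,y\in[0,\frac12]$, $f(x,y)=\phi(x)+\phi(y)-2\phi(x)\phi(y)=\frac{1-\sqrt{(1-2x)(1-2y)}}{2}$. In information quantities involving $T$, the joint law is $p(t)p(x_1|t)p(x_2|t)p(y|x_1,x_2)$ with $p(y|x_1,x_2)$ the channel law. A discrete memoryless two-user multiple access channel with noiseless feedback (MAC-FB) consists of finite input alphabets $\mathcal X_1,\mathcal X_2$, a finite output alphabet $\mathcal Y$ and a transition law $p(y|x_1,x_2)$, used memorylessly. For the channel here $\mathcal X_1=\mathcal X_2=\{0,1\}$, $\mathcal Y=\{0,1,2,3\}$. An $(n,M_1,M_2,P_e)$ code consists of message sets $\mathcal M_k=\{1,\dots,M_k\}$ ($k=1,2$), encoding functions $e_{ki}:\mathcal M_k\times\mathcal Y^{i-1}\to\mathcal X_k$ for $k=1,2$ and $i=1,\dots,n$ (the $i$-th input of user $k$ is $e_{ki}(W_k,Y_1,\dots,Y_{i-1})$), and a decoder $g:\mathcal Y^n\to\mathcal M_1\times\mathcal M_2$. The messages $W_1,W_2$ are independent and uniform on $\mathcal M_1,\mathcal M_2$, and $P_e=\Pr(g(Y^n)\ne(W_1,W_2))$.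 A pair $(R_1,R_2)$ of nonnegative reals is achievable if for every $\epsilon>0$ and all sufficiently large $n$ there is a code with $R_1\le \log(M_1)/n$, $R_2\le\log(M_2)/n$ and $P_e\le\epsilon$. The capacity region is the closure of the set of achievable pairs. *)

theory Defs
  imports "HOL-Probability.Probability"
begin

text \<open>Since \<open>log 2 0 = 0\<close>, the convention \<open>0 log 0 = 0\<close> is built in.\<close>

definition hbin :: "real \<Rightarrow> real" where
  "hbin s = - s * log 2 s - (1 - s) * log 2 (1 - s)"

definition phi :: "real \<Rightarrow> real" where
  "phi s = (if s \<le> 1/2 then (1 - sqrt (1 - 2 * s)) / 2 else (1 - sqrt (2 * s - 1)) / 2)"

definition fcomb :: "real \<Rightarrow> real \<Rightarrow> real" where
  "fcomb x y = phi x + phi y - 2 * phi x * phi y"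

lemma fcomb_eq:
  assumes "0 \<le> x" "x \<le> 1/2" "0 \<le> y" "y \<le> 1/2"
  shows "fcomb x y = (1 - sqrt ((1 - 2 * x) * (1 - 2 * y))) / 2"
  using assms unfolding real_sqrt_mult by (simp add: fcomb_def phi_def field_simps)

definition balanced :: "real \<Rightarrow> real \<Rightarrow> bool" where
  "balanced u1 u2 \<longleftrightarrow>
     u1 \<in> {0..1/4} \<and> u2 \<in> {0..1/4} \<and>
     hbin (phi (2 * u1)) = 1/2 * hbin (phi (2 * u2)) \<and>
     1/2 * hbin (phi (2 * u2)) = 1/2 * hbin ((1 - fcomb (2 * u1) (2 * u2)) / 2)"

definition is_maximum :: "real set \<Rightarrow> real \<Rightarrow> bool" where
  "is_maximum A m \<longleftrightarrow> m \<in> A \<and> (\<forall>x\<in>A. x \<le> m)"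


section \<open>Multiple access channels with noiseless feedback\<close>

text \<open>
  A channel is its transition law \<open>W x1 x2\<close>, the law of the output given the inputs.
  The output alphabet is left implicit: strings containing symbols outside the supports
  of all \<open>W x1 x2\<close> have probability 0, so the values of encoders and decoder on them play no role.

  The encoding functions \<open>e\<^sub>k\<^sub>i\<close>, for all \<open>i\<close>, are bundled into one function of the message and
  the list of past outputs (oldest first); the index is one more than the length of that list.
\<close>

record ('a, 'b, 'c) fb_code =
  msgs1 :: nat
  msgs2 :: nat
  enc1 :: "nat \<Rightarrow> 'c list \<Rightarrow> 'a"
  enc2 :: "nat \<Rightarrow> 'c list \<Rightarrow> 'b"
  dec :: "'c list \<Rightarrow> nat \<times> nat"

definition fb_code_wf :: "nat \<Rightarrow> ('a, 'b, 'c) fb_code \<Rightarrow> bool" where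
  "fb_code_wf n C \<longleftrightarrow> msgs1 C \<ge> 1 \<and> msgs2 C \<ge> 1 \<and>
     (\<forall>ys. length ys = n \<longrightarrow> dec C ys \<in> {1..msgs1 C} \<times> {1..msgs2 C})"

primrec outputs ::
    "('a \<Rightarrow> 'b \<Rightarrow> 'c pmf) \<Rightarrow> ('c list \<Rightarrow> 'a) \<Rightarrow> ('c list \<Rightarrow> 'b) \<Rightarrow> nat \<Rightarrow> 'c list pmf" where
  "outputs W e1 e2 0 = return_pmf []"
| "outputs W e1 e2 (Suc i) = do {
     ys \<leftarrow> outputs W e1 e2 i;
     y \<leftarrow> W (e1 ys) (e2 ys);
     return_pmf (ys @ [y])
   }"

definition transmission ::
    "('a \<Rightarrow> 'b \<Rightarrow> 'c pmf) \<Rightarrow> nat \<Rightarrow> ('a, 'b, 'c) fb_code \<Rightarrow> ((nat \<times> nat) \<times> 'c list) pmf" where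
  "transmission W n C = do {
     w1 \<leftarrow> pmf_of_set {1..msgs1 C};
     w2 \<leftarrow> pmf_of_set {1..msgs2 C};
     ys \<leftarrow> outputs W (enc1 C w1) (enc2 C w2) n;
     return_pmf ((w1, w2), ys)
   }"

definition error_prob :: "('a \<Rightarrow> 'b \<Rightarrow> 'c pmf) \<Rightarrow> nat \<Rightarrow> ('a, 'b, 'c) fb_code \<Rightarrow> real" where
  "error_prob W n C = measure_pmf.prob (transmission W n C) {(w, ys). dec C ys \<noteq> w}"

definition achievable :: "('a::finite \<Rightarrow> 'b::finite \<Rightarrow> 'c pmf) \<Rightarrow> real \<times> real \<Rightarrow> bool" where
  "achievable W R \<longleftrightarrow> fst R \<ge> 0 \<and> snd R \<ge> 0 \<and>
     (\<forall>\<epsilon>>0. \<forall>\<^sub>F n in sequentially. \<exists>C. fb_code_wf n C \<and>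
        fst R \<le> log 2 (real (msgs1 C)) / real n \<and>
        snd R \<le> log 2 (real (msgs2 C)) / real n \<and>
        error_prob W n C \<le> \<epsilon>)"

definition capacity_region :: "('a::finite \<Rightarrow> 'b::finite \<Rightarrow> 'c pmf) \<Rightarrow> (real \<times> real) set" where
  "capacity_region W = closure {R. achievable W R}"

text \<open>\<open>Y = X1 + X2 + N\<close> with \<open>N\<close> uniform on \<open>{0, 1}\<close>; the input 0 is \<open>False\<close>, the input 1 is \<open>True\<close>.\<close>

definition noisy_adder :: "bool \<Rightarrow> bool \<Rightarrow> nat pmf" where
  "noisy_adder x1 x2 = map_pmf (\<lambda>z. of_bool x1 + of_bool x2 + z) (pmf_of_set {0, 1})"

lemma set_pmf_noisy_adder: "(\<Union>x1 x2. set_pmf (noisy_adder x1 x2)) = {0, 1, 2, 3}"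
  by (auto simp: noisy_adder_def UNIV_bool)


section \<open>Single-letter information quantities\<close>

text \<open>
  The counting measures on whole types are the right reference measures as long as the
  random variables take values in countable types.
\<close>

definition cond_ent :: "'s pmf \<Rightarrow> ('s \<Rightarrow> 'a) \<Rightarrow> ('s \<Rightarrow> 'b) \<Rightarrow> real" where
  "cond_ent J X Z =
     prob_space.conditional_entropy (measure_pmf J) 2 (count_space UNIV) (count_space UNIV) X Z"

definition mut_inf :: "'s pmf \<Rightarrow> ('s \<Rightarrow> 'a) \<Rightarrow> ('s \<Rightarrow> 'b) \<Rightarrow> real" where
  "mut_inf J X Y =
     prob_space.mutual_information (measure_pmf J) 2 (count_space UNIV) (count_space UNIV) X Y"

definition cond_mut_inf ::
    "'s pmf \<Rightarrow> ('s \<Rightarrow> 'a) \<Rightarrow> ('s \<Rightarrow> 'b) \<Rightarrow> ('s \<Rightarrow> 'c) \<Rightarrow> real" where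
  "cond_mut_inf J X Y Z =
     prob_space.conditional_mutual_information (measure_pmf J) 2
       (count_space UNIV) (count_space UNIV) (count_space UNIV) X Y Z"

definition joint_law ::
    "('a \<Rightarrow> 'b \<Rightarrow> 'c pmf) \<Rightarrow> 't pmf \<Rightarrow> ('t \<Rightarrow> 'a pmf) \<Rightarrow> ('t \<Rightarrow> 'b pmf) \<Rightarrow> ('t \<times> 'a \<times> 'b \<times> 'c) pmf" where
  "joint_law W pT q1 q2 = do {
     t \<leftarrow> pT;
     x1 \<leftarrow> q1 t;
     x2 \<leftarrow> q2 t;
     y \<leftarrow> W x1 x2;
     return_pmf (t, x1, x2, y)
   }"

definition rate_constraints ::
    "('a \<Rightarrow> 'b \<Rightarrow> 'c pmf) \<Rightarrow> 't pmf \<Rightarrow> ('t \<Rightarrow> 'a pmf) \<Rightarrow> ('t \<Rightarrow> 'b pmf) \<Rightarrow> real \<Rightarrow> bool" where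
  "rate_constraints W pT q1 q2 R \<longleftrightarrow>
     (let J = joint_law W pT q1 q2;
          T = (\<lambda>(t, x1, x2, y). t);
          X1 = (\<lambda>(t, x1, x2, y). x1);
          X2 = (\<lambda>(t, x1, x2, y). x2);
          Y = (\<lambda>(t, x1, x2, y). y)
      in R \<le> min (cond_mut_inf J X1 Y X2) (cond_ent J X1 T) \<and>
         R \<le> 1/2 * cond_ent J X2 T \<and>
         2 * R \<le> mut_inf J (\<lambda>\<omega>. (X1 \<omega>, X2 \<omega>)) Y)"

end

theory Submission
  imports Defs
begin

text \<open>Write \<open>s\<^sub>k = phi (2 * u\<^sub>k)\<close> and \<open>f = s\<^sub>1 + s\<^sub>2 - 2 s\<^sub>1 s\<^sub>2\<close> for the balanced pair, and \<open>R\<close> for the common value. Everything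
  follows from one pointwise inequality: there are multipliers \<open>c\<^sub>1, c\<^sub>2 \<ge> 0\<close> such that for all \<open>a, b\<close> in \<open>[0, 1]\<close>

  \<open>cross f a b + c\<^sub>1 (h(a) - R) + c\<^sub>2 (h(b) - 2 R) \<le> 2 R\<close>,

  where \<open>cross f\<close> is an upper bound, linear in \<open>Pr(X\<^sub>1 \<noteq> X\<^sub>2)\<close>, for the sum-rate term. It combines the concavity of \<open>h\<close> as a
  function of \<open>a (1 - a)\<close> with the inequality of arithmetic and geometric means. Being affine in the three rate terms, it may be averaged over \<open>T\<close>, or over the
  time instants and the past of a code.

  For a code, take as \<open>T\<close> the past outputs together with the past inputs of the first user. Given these,
  the messages remain independent, and the channel is so simple that each of them is uniform on the set of messages not yet excluded.
  The entropies of the messages can therefore be followed by counting.\<close>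

section \<open>Binary entropy and the Lagrangian inequality\<close>

text \<open>The obstacle is that feedback makes the inputs dependent: given the outputs alone, an
  output 1 or 2 excludes pairs of inputs and leaves a set of message pairs that need not be a
  product. Once the first input is known as well, each output restricts the second input alone, and
  the candidates stay a product. Recording that input costs the first user its whole input entropy
  \<open>h(a)\<close>. The second user's input is exposed only when the noise fails to hide it, with
  probability 1/2, which costs \<open>h(b) / 2\<close> on average. This explains the asymmetry
  between \<open>H(X1|T)\<close> and \<open>H(X2|T) / 2\<close>.

  The sum rate involves the entropy of the output law averaged over \<open>T\<close>. Cross entropy
  relative to the output law of the balanced pair turns it into an affine function of that law, so
  that averaging costs nothing. What remains is the bilinear term \<open>a + b - 2 * a * b\<close>.
  In \<open>x = 1 - 2 * a\<close> and \<open>y = 1 - 2 * b\<close> it contains only the product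
  \<open>x * y\<close>, while \<open>a * (1 - a)\<close> and \<open>b * (1 - b)\<close> contain only
  squares; hence the choice of these variables. Every inequality used is tight at the balanced pair,
  and this determines the multipliers.\<close>

lemma mult_ln_diff_le:
  fixes x y :: real
  assumes "0 \<le> x" "0 < y"
  shows "x * (ln y - ln x) \<le> y - x"
proof (cases "x = 0")
  case False
  with assms have "x * ln (y / x) \<le> x * (y / x - 1)"
    by (intro mult_left_mono ln_le_minus_one) auto
  with False assms show ?thesis by (simp add: ln_div algebra_simps)
qed (use assms in auto)

lemma hbin_sym: "hbin (1 - s) = hbin s"
  by (simp add: hbin_def algebra_simps)

lemma hbin_ln: "hbin s * ln 2 = - s * ln s - (1 - s) * ln (1 - s)"
  by (simp add: hbin_def log_def field_simps)

lemma hbin_gibbs_strict: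
  assumes "0 \<le> s" "s \<le> 1" "0 < r" "r < 1" "s \<noteq> r"
  shows "hbin s < - s * log 2 r - (1 - s) * log 2 (1 - r)"
proof -
  have strict: "x * (ln y - ln x) < y - x" if "0 \<le> x" "0 < y" "x \<noteq> y" for x y :: real
  proof (cases "x = 0")
    case False
    have "ln (y / x) \<noteq> y / x - 1"
      using ln_eq_minus_one[of "y / x"] that False by auto
    moreover have "ln (y / x) \<le> y / x - 1"
      using that False by (intro ln_le_minus_one) auto
    ultimately have "x * ln (y / x) < x * (y / x - 1)"
      using that False by (intro mult_strict_left_mono) auto
    with False that show ?thesis by (simp add: ln_div algebra_simps)
  qed (use that in auto)
  have "s * (ln r - ln s) + (1 - s) * (ln (1 - r) - ln (1 - s)) < (r - s) + ((1 - r) - (1 - s))"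
    using assms by (intro add_less_le_mono strict mult_ln_diff_le) auto
  then have "hbin s * ln 2 < (- s * log 2 r - (1 - s) * log 2 (1 - r)) * ln 2"
    unfolding hbin_ln left_diff_distrib by (simp add: log_def algebra_simps)
  then show ?thesis by simp
qed

lemma hbin_gibbs:
  assumes "0 \<le> s" "s \<le> 1" "0 < r" "r < 1"
  shows "hbin s \<le> - s * log 2 r - (1 - s) * log 2 (1 - r)"
  using hbin_gibbs_strict[OF assms] by (cases "s = r") (auto simp: hbin_def)

text \<open>The cross entropy relative to \<open>t\<close> is the tangent of \<open>hbin\<close> at
  \<open>t\<close>. Its slope is nonnegative for \<open>t\<close> at most 1/2, and strictness comes
  from Gibbs' inequality.\<close>

lemma hbin_less:
  assumes "0 \<le> s" "s < t" "t \<le> 1/2"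
  shows "hbin s < hbin t"
proof -
  have "hbin s < - s * log 2 t - (1 - s) * log 2 (1 - t)"
    using assms by (intro hbin_gibbs_strict) auto
  also have "\<dots> = hbin t - (t - s) * (log 2 (1 - t) - log 2 t)"
    by (simp add: hbin_def algebra_simps)
  also have "\<dots> \<le> hbin t"
    using assms by simp
  finally show ?thesis .
qed

lemma hbin_le_iff:
  assumes "s \<in> {0..1/2}" "t \<in> {0..1/2}"
  shows "hbin s \<le> hbin t \<longleftrightarrow> s \<le> t"
  using hbin_less[of s t] hbin_less[of t s] assms by force

lemma hbin_eq_iff:
  assumes "s \<in> {0..1/2}" "t \<in> {0..1/2}"
  shows "hbin s = hbin t \<longleftrightarrow> s = t"
  using hbin_le_iff[OF assms] hbin_le_iff[OF assms(2,1)] by force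

lemma hbin_nonneg: "0 \<le> s \<Longrightarrow> s \<le> 1 \<Longrightarrow> 0 \<le> hbin s"
proof -
  assume "0 \<le> s" "s \<le> 1"
  then have "s * log 2 s \<le> 0" "(1 - s) * log 2 (1 - s) \<le> 0"
    by (cases "s = 0"; cases "s = 1"; simp add: mult_nonneg_nonpos)+
  then show ?thesis by (simp add: hbin_def)
qed

lemma continuous_on_mult_ln: "continuous_on {0..} (\<lambda>x::real. x * ln x)"
  unfolding continuous_on_def
proof
  fix x :: real assume x: "x \<in> {0..}"
  show "((\<lambda>x. x * ln x) \<longlongrightarrow> x * ln x) (at x within {0..})"
  proof (cases "x = 0")
    case True
    have "((\<lambda>x::real. x * ln x) \<longlongrightarrow> 0) (at_right 0)" by real_asymp
    moreover have "at 0 within {0..} = at_right (0::real)"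
      by (rule at_within_nhd[of _ "UNIV"]) auto
    ultimately show ?thesis using True by simp
  qed (use x in \<open>auto intro!: tendsto_intros\<close>)
qed

lemma continuous_on_hbin: "continuous_on {0..1} hbin"
proof -
  have "hbin = (\<lambda>s. - (s * ln s) / ln 2 - ((1 - s) * ln (1 - s)) / ln 2)"
    by (auto simp: hbin_def log_def fun_eq_iff)
  moreover have "continuous_on {0..1} \<dots>"
    by (intro continuous_intros continuous_on_subset[OF continuous_on_mult_ln]
          continuous_on_compose2[OF continuous_on_mult_ln]) auto
  ultimately show ?thesis by (simp only:)
qed

text \<open>The slope of \<open>hbin\<close> as a function of \<open>s * (1 - s)\<close>.\<close>

definition slope :: "real \<Rightarrow> real" where
  "slope s = (log 2 (1 - s) - log 2 s) / (1 - 2 * s)"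

lemma slope_pos: "0 < s \<Longrightarrow> s < 1/2 \<Longrightarrow> 0 < slope s"
  by (simp add: slope_def)

text \<open>Up to a negative factor, \<open>slope x\<close> is the slope of the chord of
  \<open>ln (1 - x) - ln x\<close> from \<open>x\<close> to its zero 1/2. Chord slopes of a convex
  function with one end fixed are monotone.\<close>

lemma slope_antimono:
  assumes "0 < a" "a \<le> b" "b < 1/2"
  shows "slope b \<le> slope a"
proof -
  define \<psi> where "\<psi> = (\<lambda>x::real. ln (1 - x) - ln x)"
  have cvx: "convex_on {a..1/2} \<psi>"
    unfolding \<psi>_def
  proof (rule f''_ge0_imp_convex)
    fix x assume x: "x \<in> {a..1/2}"
    show "((\<lambda>x. ln (1 - x) - ln x) has_real_derivative - 1 / (1 - x) - 1 / x) (at x)"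
      using x assms by (auto intro!: derivative_eq_intros)
    show "((\<lambda>x. - 1 / (1 - x) - 1 / x) has_real_derivative - 1 / (1 - x)^2 + 1 / x^2) (at x)"
      using x assms by (auto intro!: derivative_eq_intros simp: power2_eq_square)
    have "x^2 \<le> (1 - x)^2" using x assms by (intro power_mono) auto
    then have "1 / (1 - x)^2 \<le> 1 / x^2"
      using x assms by (intro divide_left_mono) auto
    then show "0 \<le> - 1 / (1 - x)^2 + 1 / x^2" by simp
  qed simp
  \<comment> \<open>The weight that writes \<open>b\<close> as a convex combination of
    \<open>a\<close> and 1/2.\<close>
  define t where "t = 2 * (b - a) / (1 - 2 * a)"
  have t: "0 \<le> t" "t \<le> 1" using assms by (auto simp: t_def field_simps)
  have "t * (1 - 2 * a) = 2 * (b - a)" using assms by (simp add: t_def)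
  then have b: "b = (1 - t) * a + t * (1/2)" by (simp add: algebra_simps)
  have "\<psi> b \<le> (1 - t) * \<psi> a + t * \<psi> (1/2)"
    using convex_onD[OF cvx, of t a "1/2"] t assms b by simp
  also have "\<psi> (1/2) = 0" by (simp add: \<psi>_def)
  finally have "\<psi> b \<le> (1 - t) * \<psi> a" by simp
  moreover have "1 - 2 * b = (1 - t) * (1 - 2 * a)" by (simp add: b algebra_simps)
  moreover have "1 - t > 0" using assms by (simp add: t_def field_simps)
  ultimately have "\<psi> b / (1 - 2 * b) \<le> ((1 - t) * \<psi> a) / ((1 - t) * (1 - 2 * a))"
    using assms by (simp only:) (intro divide_right_mono, auto)
  also have "\<dots> = \<psi> a / (1 - 2 * a)" using \<open>1 - t > 0\<close> by simp
  finally have "\<psi> b / (1 - 2 * b) / ln 2 \<le> \<psi> a / (1 - 2 * a) / ln 2"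
    by (intro divide_right_mono) auto
  moreover have "slope x = \<psi> x / (1 - 2 * x) / ln 2" for x
    by (simp add: \<psi>_def slope_def log_def diff_divide_distrib mult.commute)
  ultimately show ?thesis by simp
qed

text \<open>This is concavity of \<open>hbin\<close> in the variable \<open>a * (1 - a)\<close>. The
  difference of the two sides has derivative \<open>(1 - 2 * x) * (slope x - slope s)\<close> on the
  left half of the interval, which changes sign only at \<open>s\<close>; the right half follows by
  symmetry.\<close>

lemma hbin_le_tangent:
  assumes s: "0 < s" "s < 1/2" and a: "0 \<le> a" "a \<le> 1"
  shows "hbin a \<le> hbin s + slope s * (a * (1 - a) - s * (1 - s))"
proof -
  define \<Phi> where "\<Phi> = (\<lambda>x. hbin x - slope s * (x * (1 - x)))"
  have cont: "continuous_on {0..1/2} \<Phi>"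
    unfolding \<Phi>_def by (intro continuous_intros continuous_on_subset[OF continuous_on_hbin]) auto
  have der: "(\<Phi> has_real_derivative (1 - 2 * x) * (slope x - slope s)) (at x)" if "0 < x" "x < 1/2" for x
  proof -
    have 1: "((\<lambda>x. x * ln x) has_real_derivative ln x + 1) (at x)"
      using that by (auto intro!: derivative_eq_intros)
    have 2: "((\<lambda>x. (1 - x) * ln (1 - x)) has_real_derivative - ln (1 - x) - 1) (at x)"
      using that by (auto intro!: derivative_eq_intros)
    have 3: "((\<lambda>x. slope s * (x * (1 - x))) has_real_derivative slope s * (1 - 2 * x)) (at x)"
      by (auto intro!: derivative_eq_intros)
    have \<Phi>: "\<Phi> = (\<lambda>x. (- (x * ln x) - (1 - x) * ln (1 - x)) / ln 2 - slope s * (x * (1 - x)))"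
      by (auto simp: \<Phi>_def hbin_def log_def fun_eq_iff diff_divide_distrib)
    have "(\<Phi> has_real_derivative log 2 (1 - x) - log 2 x - slope s * (1 - 2 * x)) (at x)"
      unfolding \<Phi>
      by (rule DERIV_cong[OF DERIV_diff[OF DERIV_cdivide[OF DERIV_diff[OF DERIV_minus[OF 1] 2]] 3]])
        (simp add: log_def diff_divide_distrib)
    moreover have "log 2 (1 - x) - log 2 x = (1 - 2 * x) * slope x"
      using that by (simp add: slope_def)
    ultimately show ?thesis by (simp add: algebra_simps)
  qed
  have main: "\<Phi> x \<le> \<Phi> s" if x: "0 \<le> x" "x \<le> 1/2" for x
  proof (cases "x \<le> s")
    case True
    show ?thesis
    proof (rule DERIV_nonneg_imp_increasing_open[OF True])
      fix z assume z: "x < z" "z < s"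
      then show "\<exists>y. (\<Phi> has_real_derivative y) (at z) \<and> 0 \<le> y"
        using x s slope_antimono[of z s] der[of z] by (intro exI[of _ "(1 - 2 * z) * (slope z - slope s)"]) auto
    qed (rule continuous_on_subset[OF cont], use x s in auto)
  next
    case False
    show ?thesis
    proof (rule DERIV_nonpos_imp_decreasing_open[of s x])
      fix z assume z: "s < z" "z < x"
      then show "\<exists>y. (\<Phi> has_real_derivative y) (at z) \<and> y \<le> 0"
        using x s slope_antimono[of s z] der[of z]
        by (intro exI[of _ "(1 - 2 * z) * (slope z - slope s)"]) (auto simp: mult_nonneg_nonpos)
    qed (use False in simp, rule continuous_on_subset[OF cont], use x s in auto)
  qed
  have "\<Phi> a \<le> \<Phi> s"
  proof (cases "a \<le> 1/2")
    case False
    have "\<Phi> a = \<Phi> (1 - a)" by (simp add: \<Phi>_def hbin_sym mult.commute)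
    with main[of "1 - a"] False a show ?thesis by simp
  qed (use main a in auto)
  then show ?thesis by (simp add: \<Phi>_def algebra_simps)
qed

text \<open>The cross entropy of the output of the noisy adder, whose inputs are independent and equal 0
  with probabilities \<open>a\<close> and \<open>b\<close>, relative to the symmetric law with \<open>Pr(Y = 0) = (1 - f) / 4\<close>,
  less the noise entropy 1.\<close>

definition cross :: "real \<Rightarrow> real \<Rightarrow> real \<Rightarrow> real" where
  "cross f a b = - (1 - (a + b - 2 * a * b)) / 2 * log 2 ((1 - f) / 2)
     - (1 + (a + b - 2 * a * b)) / 2 * log 2 ((1 + f) / 2)"

lemma hbin_le_cross:
  assumes "0 \<le> a + b - 2 * a * b" "a + b - 2 * a * b \<le> 1" "0 < f" "f < 1"
  shows "hbin ((1 - (a + b - 2 * a * b)) / 2) \<le> cross f a b"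
proof -
  have "1 - (1 - f) / 2 = (1 + f) / 2" "1 - (1 - (a + b - 2 * a * b)) / 2 = (1 + (a + b - 2 * a * b)) / 2"
    by (simp_all add: field_simps)
  with hbin_gibbs[of "(1 - (a + b - 2 * a * b)) / 2" "(1 - f) / 2"] assms show ?thesis
    unfolding cross_def minus_divide_left by simp
qed

text \<open>As a function of \<open>a + b - 2 * a * b\<close>, \<open>cross f\<close> is the tangent
  at \<open>f\<close> of the sum rate \<open>hbin ((1 - f) / 2)\<close>.\<close>

lemma cross_tangent:
  "cross f a b = hbin ((1 - f) / 2) - (a + b - 2 * a * b - f) * (log 2 ((1 + f) / 2) - log 2 ((1 - f) / 2)) / 2"
proof -
  have "1 - (1 - f) / 2 = (1 + f) / 2" by (simp add: field_simps)
  then show ?thesis unfolding hbin_def cross_def by (simp only:) argo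
qed

text \<open>With \<open>x = 1 - 2 * a\<close>, \<open>y = 1 - 2 * b\<close> and \<open>p\<close>,
  \<open>q\<close> likewise from \<open>s1\<close>, \<open>s2\<close>, the claim is
  \<open>2 * x * y \<le> q / p * x^2 + p / q * y^2\<close>. The weight \<open>lam = q / p\<close> is
  the one giving equality at \<open>x = p\<close>, \<open>y = q\<close>.\<close>

lemma conv_tangent:
  fixes a b s1 s2 :: real
  assumes "s1 < 1/2" "s2 < 1/2"
  defines "lam \<equiv> (1 - 2 * s2) / (1 - 2 * s1)"
  shows "(a + b - 2 * a * b) - (s1 + s2 - 2 * s1 * s2) \<ge>
    lam * (a * (1 - a) - s1 * (1 - s1)) + 1 / lam * (b * (1 - b) - s2 * (1 - s2))"
proof -
  define p q where "p = 1 - 2 * s1" and "q = 1 - 2 * s2"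
  have pq: "0 < p" "0 < q" using assms by (auto simp: p_def q_def)
  have s: "s1 = (1 - p) / 2" "s2 = (1 - q) / 2" by (auto simp: p_def q_def)
  define x y where "x = 1 - 2 * a" and "y = 1 - 2 * b"
  have ab: "a = (1 - x) / 2" "b = (1 - y) / 2" by (auto simp: x_def y_def)
  have "0 \<le> (q * x - p * y)^2" by simp
  then have "2 * x * y * p * q \<le> q^2 * x^2 + p^2 * y^2" by (simp add: power2_eq_square algebra_simps)
  then have "2 * x * y \<le> q / p * x^2 + p / q * y^2"
    using pq by (simp add: field_simps power2_eq_square)
  moreover have "lam = q / p" by (simp add: lam_def p_def q_def)
  moreover have "q / p * p^2 = p * q" "p / q * q^2 = p * q" using pq by (auto simp: power2_eq_square)
  ultimately show ?thesis unfolding s ab by (simp add: power2_eq_square algebra_simps add_divide_distrib diff_divide_distrib)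
qed

lemma lagrange:
  assumes s: "0 < s1" "s1 < 1/2" "0 < s2" "s2 < 1/2"
    and f: "f = s1 + s2 - 2 * s1 * s2"
  obtains c1 c2 where "0 \<le> c1" "0 \<le> c2"
    "\<And>a b. a \<in> {0..1} \<Longrightarrow> b \<in> {0..1} \<Longrightarrow>
      cross f a b + c1 * (hbin a - hbin s1) + c2 * (hbin b - hbin s2) \<le> hbin ((1 - f) / 2)"
proof -
  define lam where "lam = (1 - 2 * s2) / (1 - 2 * s1)"
  have lam_pos: "lam > 0" using s by (simp add: lam_def)
  have f2: "1 - 2 * f = (1 - 2 * s1) * (1 - 2 * s2)" by (simp add: f algebra_simps)
  have "(1 - 2 * s1) * (1 - 2 * s2) > 0" "(1 - 2 * s1) * (1 - 2 * s2) < 1 * 1"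
    using s by (simp, intro mult_strict_mono, auto)
  with f2 have fb: "0 < f" "f < 1/2" by linarith+
  define c3 where "c3 = (log 2 ((1 + f) / 2) - log 2 ((1 - f) / 2)) / 2"
  have c3: "c3 > 0" using fb by (simp add: c3_def)
  note sl = slope_pos[OF s(1,2)] slope_pos[OF s(3,4)]
  show thesis
  proof (rule that[of "c3 * lam / slope s1" "c3 / lam / slope s2"])
    fix a b :: real assume ab: "a \<in> {0..1}" "b \<in> {0..1}"
    have 1: "(hbin a - hbin s1) / slope s1 \<le> a * (1 - a) - s1 * (1 - s1)"
      using hbin_le_tangent[OF s(1,2), of a] ab sl by (simp add: field_simps)
    have 2: "(hbin b - hbin s2) / slope s2 \<le> b * (1 - b) - s2 * (1 - s2)"
      using hbin_le_tangent[OF s(3,4), of b] ab sl by (simp add: field_simps)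
    have "lam * ((hbin a - hbin s1) / slope s1) + 1 / lam * ((hbin b - hbin s2) / slope s2)
        \<le> (a + b - 2 * a * b) - f"
    proof -
      have "lam * ((hbin a - hbin s1) / slope s1) \<le> lam * (a * (1 - a) - s1 * (1 - s1))"
        using 1 lam_pos by (intro mult_left_mono) auto
      moreover have "1 / lam * ((hbin b - hbin s2) / slope s2) \<le> 1 / lam * (b * (1 - b) - s2 * (1 - s2))"
        using 2 lam_pos by (intro mult_left_mono) auto
      moreover note conv_tangent[OF s(2,4), of a b, folded lam_def f]
      ultimately show ?thesis by linarith
    qed
    then have "c3 * (lam * ((hbin a - hbin s1) / slope s1) + 1 / lam * ((hbin b - hbin s2) / slope s2))
        \<le> c3 * ((a + b - 2 * a * b) - f)"
      using c3 by (intro mult_left_mono) auto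
    also have "c3 * (lam * ((hbin a - hbin s1) / slope s1) + 1 / lam * ((hbin b - hbin s2) / slope s2))
      = c3 * lam / slope s1 * (hbin a - hbin s1) + c3 / lam / slope s2 * (hbin b - hbin s2)"
      unfolding distrib_left divide_inverse by (simp only: mult_ac mult_1)
    finally have "c3 * lam / slope s1 * (hbin a - hbin s1) + c3 / lam / slope s2 * (hbin b - hbin s2)
       \<le> c3 * ((a + b - 2 * a * b) - f)" .
    then show "cross f a b + c3 * lam / slope s1 * (hbin a - hbin s1)
        + c3 / lam / slope s2 * (hbin b - hbin s2) \<le> hbin ((1 - f) / 2)"
      unfolding cross_tangent by (simp add: c3_def mult.commute)
  qed (use c3 lam_pos sl in auto)
qed

section \<open>The balanced pair\<close>

lemma ln_2_bounds: "ln (2 :: real) \<in> {1386294361/2000000000..3465735903/5000000000}"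
  using ln_approx_bounds[of "2" 10] by (simp add: lessThan_nat_numeral power_divide)

text \<open>Together with 2, the quotients 3/2, 8/7 and 19/18 generate the logarithms of 2, 3, 7 and
  19. The closer the argument is to 1, the fewer terms of the series are needed for ten
  decimals.\<close>

lemma ln_3_2_bounds: "ln (3/2 :: real) \<in> {4054651081/10000000000..2027325541/5000000000}"
  using ln_approx_bounds[of "3/2" 7] by (simp add: lessThan_nat_numeral power_divide)

lemma ln_8_7_bounds: "ln (8/7 :: real) \<in> {667656963/5000000000..1335313927/10000000000}"
  using ln_approx_bounds[of "8/7" 4] by (simp add: lessThan_nat_numeral power_divide)

lemma ln_19_18_bounds: "ln (19/18 :: real) \<in> {135168053/2500000000..540672213/10000000000}"
  using ln_approx_bounds[of "19/18" 3] by (simp add: lessThan_nat_numeral power_divide)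

text \<open>Fractions with prime factors 2, 3, 7 and 19 only, close to the points at which \<open>hbin\<close> is evaluated below;
  near them, one term of the series of the logarithm suffices.\<close>

lemma ln_reference_points:
  "ln (2/21 :: real) \<in> {-11756876287/5000000000..-23513752569/10000000000}"
  "ln (19/21 :: real) \<in> {-1000834587/10000000000..-1000834583/10000000000}"
  "ln (9/28 :: real) \<in> {-1134979933/1000000000..-2837449831/2500000000}"
  "ln (19/28 :: real) \<in> {-242353457/625000000..-1938827653/5000000000}"
proof -
  have "ln (8/7) = 3 * ln 2 - ln (7::real)" "ln (3/2) = ln 3 - ln (2::real)"
    "ln (19/18) = ln 19 - 2 * ln 3 - ln (2::real)"
    "ln (2/21) = ln 2 - ln 3 - ln (7::real)" "ln (19/21) = ln 19 - ln 3 - ln (7::real)"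
    "ln (9/28) = 2 * ln 3 - 2 * ln 2 - ln (7::real)" "ln (19/28) = ln 19 - 2 * ln 2 - ln (7::real)"
    using ln_mult_pos[of 3 "7::real"] ln_mult_pos[of 9 "2::real"] ln_mult_pos[of 4 "7::real"]
      ln_realpow[of 2 3] ln_realpow[of 3 2] ln_realpow[of 2 2] by (simp_all add: ln_div)
  then have e: "ln (2/21 :: real) = ln (8/7) - 3 * ln 2 - ln (3/2)"
    "ln (19/21 :: real) = ln (19/18) + ln (3/2) + ln (8/7) - ln 2"
    "ln (9/28 :: real) = 2 * ln (3/2) + ln (8/7) - 3 * ln 2"
    "ln (19/28 :: real) = ln (19/18) + 2 * ln (3/2) + ln (8/7) - 2 * ln 2"
    by linarith+
  show "ln (2/21 :: real) \<in> {-11756876287/5000000000..-23513752569/10000000000}"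
    using ln_2_bounds ln_3_2_bounds ln_8_7_bounds ln_19_18_bounds unfolding e atLeastAtMost_iff by linarith
  show "ln (19/21 :: real) \<in> {-1000834587/10000000000..-1000834583/10000000000}"
    using ln_2_bounds ln_3_2_bounds ln_8_7_bounds ln_19_18_bounds unfolding e atLeastAtMost_iff by linarith
  show "ln (9/28 :: real) \<in> {-1134979933/1000000000..-2837449831/2500000000}"
    using ln_2_bounds ln_3_2_bounds ln_8_7_bounds ln_19_18_bounds unfolding e atLeastAtMost_iff by linarith
  show "ln (19/28 :: real) \<in> {-242353457/625000000..-1938827653/5000000000}"
    using ln_2_bounds ln_3_2_bounds ln_8_7_bounds ln_19_18_bounds unfolding e atLeastAtMost_iff by linarith
qed

text \<open>The first term of \<open>ln (s / r) = 2 * artanh y\<close>, with the tail bounded by a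
  geometric series.\<close>

lemma ln_bounds_near:
  fixes s r :: real
  assumes "0 < r" "r < s" "y = (s - r) / (s + r)"
  shows "ln s \<in> {ln r + 2 * y..ln r + 2 * y + 2 * y^3 / (3 * (1 - y^2))}"
proof -
  have "s / r - 1 = (s - r) / r" "s / r + 1 = (s + r) / r"
    using assms by (auto simp: field_simps)
  then have "(s / r - 1) / (s / r + 1) = y"
    using assms by simp
  with ln_approx_bounds[of "s / r" 1] assms show ?thesis
    by (simp add: ln_div numeral_3_eq_3 mult_ac)
qed

text \<open>This and the seven similar evaluations serve as sign tests for the existence of the
  balanced pair: the arguments are ends of the intervals for \<open>s1\<close> and
  \<open>s2\<close>, or bounds for \<open>s2\<close> and for \<open>(1 - f) / 2\<close> at those
  ends. The factor \<open>ln 2\<close> keeps everything in natural logarithms and cancels in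
  comparisons.\<close>

lemma hbin_095109: "hbin (95109/1000000) * ln 2 \<in> {3142014731/10000000000..3142014737/10000000000}"
proof -
  have 1: "ln (2/21) - ln (95109/1000000 :: real) \<in> {13564193/10000000000..3391049/2500000000}"
    using ln_bounds_near[of "95109/1000000" "2/21" "2711/3997289"] by (simp add: power_divide)
  have 2: "ln (904891/1000000) - ln (19/21 :: real) \<in> {71337/500000000..1426741/10000000000}"
    using ln_bounds_near[of "19/21" "904891/1000000" "2711/38002711"] by (simp add: power_divide)
  have 3: "ln (95109/1000000 :: real) \<in> {-2352731677/1000000000..-11763658381/5000000000}"
    using 1 ln_reference_points(1) unfolding atLeastAtMost_iff by linarith
  have 4: "ln (904891/1000000 :: real) \<in> {-999407847/10000000000..-499703921/5000000000}"
    using 2 ln_reference_points(2) unfolding atLeastAtMost_iff by linarith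
  have "hbin (95109/1000000) * ln 2 = - (95109/1000000) * ln (95109/1000000) - 904891/1000000 * ln (904891/1000000)"
    unfolding hbin_ln by simp
  then show ?thesis
    using 3 4 unfolding atLeastAtMost_iff by linarith
qed

lemma hbin_09510953: "hbin (9510953/100000000) * ln 2 \<in> {3142026671/10000000000..3142026677/10000000000}"
proof -
  have 1: "ln (2/21) - ln (9510953/100000000 :: real) \<in> {13508467/10000000000..1350847/1000000000}"
    using ln_bounds_near[of "9510953/100000000" "2/21" "269987/399730013"] by (simp add: power_divide)
  have 2: "ln (90489047/100000000) - ln (19/21 :: real) \<in> {1420883/10000000000..355221/2500000000}"
    using ln_bounds_near[of "19/21" "90489047/100000000" "269987/3800269987"] by (simp add: power_divide)
  have 3: "ln (9510953/100000000 :: real) \<in> {-5881815261/2500000000..-5881815259/2500000000}"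
    using 1 ln_reference_points(1) unfolding atLeastAtMost_iff by linarith
  have 4: "ln (90489047/100000000 :: real) \<in> {-124926713/1250000000..-999413699/10000000000}"
    using 2 ln_reference_points(2) unfolding atLeastAtMost_iff by linarith
  have "hbin (9510953/100000000) * ln 2 = - (9510953/100000000) * ln (9510953/100000000) - 90489047/100000000 * ln (90489047/100000000)"
    unfolding hbin_ln by simp
  then show ?thesis
    using 3 4 unfolding atLeastAtMost_iff by linarith
qed

lemma hbin_3220473: "hbin (3220473/10000000) * ln 2 \<in> {3142015169/5000000000..1571007587/2500000000}"
proof -
  have 1: "ln (3220473/10000000) - ln (9/28 :: real) \<in> {2403853/1250000000..19230831/10000000000}"
    using ln_bounds_near[of "9/28" "3220473/10000000" "14437/15014437"] by (simp add: power_divide)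
  have 2: "ln (19/28) - ln (6779527/10000000 :: real) \<in> {1140283/1250000000..1824453/2000000000}"
    using ln_bounds_near[of "6779527/10000000" "19/28" "43311/94956689"] by (simp add: power_divide)
  have 3: "ln (3220473/10000000 :: real) \<in> {-5665284253/5000000000..-11330568493/10000000000}"
    using 1 ln_reference_points(3) unfolding atLeastAtMost_iff by linarith
  have 4: "ln (6779527/10000000 :: real) \<in> {-3886777577/10000000000..-388677757/1000000000}"
    using 2 ln_reference_points(4) unfolding atLeastAtMost_iff by linarith
  have "hbin (3220473/10000000) * ln 2 = - (3220473/10000000) * ln (3220473/10000000) - 6779527/10000000 * ln (6779527/10000000)"
    unfolding hbin_ln by simp
  then show ?thesis
    using 3 4 unfolding atLeastAtMost_iff by linarith
qed

lemma hbin_3220465: "hbin (644093/2000000) * ln 2 \<in> {3142012191/5000000000..6284024393/10000000000}"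
proof -
  have 1: "ln (644093/2000000) - ln (9/28 :: real) \<in> {19205983/10000000000..1920599/1000000000}"
    using ln_bounds_near[of "9/28" "644093/2000000" "8651/9008651"] by (simp add: power_divide)
  have 2: "ln (19/28) - ln (1355907/2000000 :: real) \<in> {9110463/10000000000..1822093/2000000000}"
    using ln_bounds_near[of "1355907/2000000" "19/28" "8651/18991349"] by (simp add: power_divide)
  have 3: "ln (644093/2000000 :: real) \<in> {-11330593347/10000000000..-5665296667/5000000000}"
    using 1 ln_reference_points(3) unfolding atLeastAtMost_iff by linarith
  have 4: "ln (1355907/2000000 :: real) \<in> {-3886765777/10000000000..-3886765769/10000000000}"
    using 2 ln_reference_points(4) unfolding atLeastAtMost_iff by linarith
  have "hbin (644093/2000000) * ln 2 = - (644093/2000000) * ln (644093/2000000) - 1355907/2000000 * ln (1355907/2000000)"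
    unfolding hbin_ln by simp
  then show ?thesis
    using 3 4 unfolding atLeastAtMost_iff by linarith
qed

lemma hbin_3220503: "hbin (3220503/10000000) * ln 2 \<in> {6284052669/10000000000..6284052679/10000000000}"
proof -
  have 1: "ln (3220503/10000000) - ln (9/28 :: real) \<in> {19323977/10000000000..1207749/625000000}"
    using ln_bounds_near[of "9/28" "3220503/10000000" "14507/15014507"] by (simp add: power_divide)
  have 2: "ln (19/28) - ln (6779497/10000000 :: real) \<in> {1833303/2000000000..2291629/2500000000}"
    using ln_bounds_near[of "6779497/10000000" "19/28" "43521/94956479"] by (simp add: power_divide)
  have 3: "ln (3220503/10000000 :: real) \<in> {-11330475353/10000000000..-566523767/500000000}"
    using 1 ln_reference_points(3) unfolding atLeastAtMost_iff by linarith
  have 4: "ln (6779497/10000000 :: real) \<in> {-971705457/2500000000..-3886821821/10000000000}"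
    using 2 ln_reference_points(4) unfolding atLeastAtMost_iff by linarith
  have "hbin (3220503/10000000) * ln 2 = - (3220503/10000000) * ln (3220503/10000000) - 6779497/10000000 * ln (6779497/10000000)"
    unfolding hbin_ln by simp
  then show ?thesis
    using 3 4 unfolding atLeastAtMost_iff by linarith
qed

lemma hbin_32205045: "hbin (6441009/20000000) * ln 2 \<in> {1256810757/2000000000..1571013449/2500000000}"
proof -
  have 1: "ln (6441009/20000000) - ln (9/28 :: real) \<in> {3865727/2000000000..9664321/5000000000}"
    using ln_bounds_near[of "9/28" "6441009/20000000" "29021/30029021"] by (simp add: power_divide)
  have 2: "ln (19/28) - ln (13558991/20000000 :: real) \<in> {9168727/10000000000..9168729/10000000000}"
    using ln_bounds_near[of "13558991/20000000" "19/28" "87063/189912937"] by (simp add: power_divide)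
  have 3: "ln (6441009/20000000 :: real) \<in> {-2266094139/2000000000..-5665235341/5000000000}"
    using 1 ln_reference_points(3) unfolding atLeastAtMost_iff by linarith
  have 4: "ln (13558991/20000000 :: real) \<in> {-3886824041/10000000000..-3886824033/10000000000}"
    using 2 ln_reference_points(4) unfolding atLeastAtMost_iff by linarith
  have "hbin (6441009/20000000) * ln 2 = - (6441009/20000000) * ln (6441009/20000000) - 13558991/20000000 * ln (13558991/20000000)"
    unfolding hbin_ln by simp
  then show ?thesis
    using 3 4 unfolding atLeastAtMost_iff by linarith
qed

lemma hbin_32205: "hbin (6441/20000) * ln 2 \<in> {1571012609/2500000000..3142025223/5000000000}"
proof -
  have 1: "ln (6441/20000) - ln (9/28 :: real) \<in> {9657331/5000000000..19314669/10000000000}"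
    using ln_bounds_near[of "9/28" "6441/20000" "29/30029"] by (simp add: power_divide)
  have 2: "ln (19/28) - ln (13559/20000 :: real) \<in> {916209/1000000000..9162091/10000000000}"
    using ln_bounds_near[of "13559/20000" "19/28" "87/189913"] by (simp add: power_divide)
  have 3: "ln (6441/20000 :: real) \<in> {-2832621167/2500000000..-2266096931/2000000000}"
    using 1 ln_reference_points(3) unfolding atLeastAtMost_iff by linarith
  have 4: "ln (13559/20000 :: real) \<in> {-3886817403/10000000000..-971704349/2500000000}"
    using 2 ln_reference_points(4) unfolding atLeastAtMost_iff by linarith
  have "hbin (6441/20000) * ln 2 = - (6441/20000) * ln (6441/20000) - 13559/20000 * ln (13559/20000)"
    unfolding hbin_ln by simp
  then show ?thesis
    using 3 4 unfolding atLeastAtMost_iff by linarith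
qed

lemma hbin_322050138: "hbin (161025069/500000000) * ln 2 \<in> {6284051463/10000000000..3142025737/5000000000}"
proof -
  have 1: "ln (161025069/500000000) - ln (9/28 :: real) \<in> {19318947/10000000000..9659477/5000000000}"
    using ln_bounds_near[of "9/28" "161025069/500000000" "725161/750725161"] by (simp add: power_divide)
  have 2: "ln (19/28) - ln (338974931/500000000 :: real) \<in> {73313/80000000..9164127/10000000000}"
    using ln_bounds_near[of "338974931/500000000" "19/28" "2175483/4747824517"] by (simp add: power_divide)
  have 3: "ln (161025069/500000000 :: real) \<in> {-11330480383/10000000000..-1133048037/1000000000}"
    using 1 ln_reference_points(3) unfolding atLeastAtMost_iff by linarith
  have 4: "ln (338974931/500000000 :: real) \<in> {-3886819439/10000000000..-3886819431/10000000000}"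
    using 2 ln_reference_points(4) unfolding atLeastAtMost_iff by linarith
  have "hbin (161025069/500000000) * ln 2 = - (161025069/500000000) * ln (161025069/500000000) - 338974931/500000000 * ln (338974931/500000000)"
    unfolding hbin_ln by simp
  then show ?thesis
    using 3 4 unfolding atLeastAtMost_iff by linarith
qed

section \<open>Uniqueness and existence of the balanced pair\<close>

lemma conv_mono:
  fixes a b c d :: real
  assumes "0 \<le> a" "a \<le> b" "b \<le> 1/2" "0 \<le> c" "c \<le> d" "d \<le> 1/2"
  shows "a + c - 2 * a * c \<le> b + d - 2 * b * d"
proof -
  have "(1 - 2 * b) * (1 - 2 * d) \<le> (1 - 2 * a) * (1 - 2 * c)"
    using assms by (intro mult_mono) auto
  then show ?thesis by (simp add: algebra_simps)
qed

lemma conv_bounds: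
  fixes a c :: real
  assumes "0 \<le> a" "a \<le> 1/2" "0 \<le> c" "c \<le> 1/2"
  shows "0 \<le> a + c - 2 * a * c" "a + c - 2 * a * c \<le> 1/2"
  using conv_mono[of 0 a 0 c] conv_mono[of a "1/2" c "1/2"] assms by auto

text \<open>A larger common value would force larger \<open>t1\<close> and \<open>t2\<close>, hence
  a larger \<open>g\<close> and a smaller \<open>hbin ((1 - g) / 2)\<close>, which is that same
  common value doubled. A smaller one fails in the same way.\<close>

lemma balanced_pair_unique:
  assumes s: "0 < s1" "s1 < 1/2" "0 < s2" "s2 < 1/2"
    and f: "f = s1 + s2 - 2 * s1 * s2" and eq: "2 * hbin s1 = hbin ((1 - f) / 2)" "2 * hbin s1 = hbin s2"
    and t: "t1 \<in> {0..1/2}" "t2 \<in> {0..1/2}"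
    and g: "g = t1 + t2 - 2 * t1 * t2" and eqt: "2 * hbin t1 = hbin ((1 - g) / 2)" "2 * hbin t1 = hbin t2"
  shows "t1 = s1 \<and> t2 = s2"
proof -
  have fb: "0 \<le> f" "f \<le> 1/2"
    using conv_bounds[of s1 s2] s unfolding f by simp_all
  have gb: "0 \<le> g" "g \<le> 1/2"
    using conv_bounds[of t1 t2] t unfolding g by simp_all
  have mem: "s1 \<in> {0..1/2}" "s2 \<in> {0..1/2}" "t1 \<in> {0..1/2}" "t2 \<in> {0..1/2}"
    using s t by auto
  have "hbin t1 = hbin s1"
  proof (rule ccontr)
    assume "hbin t1 \<noteq> hbin s1"
    then consider "hbin t1 < hbin s1" | "hbin s1 < hbin t1" by linarith
    then show False
    proof cases
      case 1
      then have "hbin t1 \<le> hbin s1" "hbin t2 \<le> hbin s2"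
        using eq eqt by linarith+
      then have "t1 \<le> s1" "t2 \<le> s2"
        using mem hbin_le_iff by blast+
      then have "g \<le> f" unfolding f g using s t by (intro conv_mono) auto
      then have "hbin ((1 - f) / 2) \<le> hbin ((1 - g) / 2)"
        using fb gb by (subst hbin_le_iff) auto
      with 1 eq eqt show False by linarith
    next
      case 2
      then have "hbin s1 \<le> hbin t1" "hbin s2 \<le> hbin t2"
        using eq eqt by linarith+
      then have "s1 \<le> t1" "s2 \<le> t2"
        using mem hbin_le_iff by blast+
      then have "f \<le> g" unfolding f g using s t by (intro conv_mono) auto
      then have "hbin ((1 - g) / 2) \<le> hbin ((1 - f) / 2)"
        using fb gb by (subst hbin_le_iff) auto
      with 2 eq eqt show False by linarith
    qed
  qed
  moreover from this have "hbin t2 = hbin s2" using eq eqt by linarith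
  ultimately show ?thesis
    using mem hbin_eq_iff by blast
qed

text \<open>The equation \<open>2 * hbin s1 = hbin s2\<close> is solved for \<open>s2\<close> by a
  continuous inverse \<open>g\<close> of \<open>hbin\<close>, and the remaining equation in
  \<open>s1\<close> by the intermediate value theorem for \<open>D\<close>. The intervals are narrow
  enough to give the stated decimals of both coordinates.\<close>

lemma balanced_pair_exists:
  obtains s1 s2 :: real where
    "s1 \<in> {95109/1000000..9510953/100000000}" "s2 \<in> {644093/2000000..6441009/20000000}"
    "2 * hbin s1 = hbin s2" "2 * hbin s1 = hbin ((1 - (s1 + s2 - 2 * s1 * s2)) / 2)"
proof -
  define l1 h1 l2 h2 d d' :: real where "l1 = 95109/1000000" and "h1 = 9510953/100000000"
    and "l2 = 644093/2000000" and "h2 = 6441009/20000000"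
    and "d = 3220473/10000000" and "d' = 3220503/10000000"
  note defs = l1_def h1_def l2_def h2_def d_def d'_def
  have transfer: "x < y" if "x * ln 2 < y * ln (2::real)" for x y
    using that by simp
  have num1: "hbin l2 < 2 * hbin l1"
    unfolding defs by (rule transfer) (use hbin_3220465 hbin_095109 in \<open>unfold atLeastAtMost_iff, linarith\<close>)
  have num2: "2 * hbin l1 < hbin d"
    unfolding defs by (rule transfer) (use hbin_3220473 hbin_095109 in \<open>unfold atLeastAtMost_iff, linarith\<close>)
  have num3: "2 * hbin l1 < hbin (6441/20000)"
    unfolding defs by (rule transfer) (use hbin_32205 hbin_095109 in \<open>unfold atLeastAtMost_iff, linarith\<close>)
  have num4: "2 * hbin h1 < hbin h2"
    unfolding defs by (rule transfer) (use hbin_32205045 hbin_09510953 in \<open>unfold atLeastAtMost_iff, linarith\<close>)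
  have num5: "hbin d' < 2 * hbin h1"
    unfolding defs by (rule transfer) (use hbin_3220503 hbin_09510953 in \<open>unfold atLeastAtMost_iff, linarith\<close>)
  have num6: "hbin (161025069/500000000) < 2 * hbin h1"
    unfolding defs by (rule transfer) (use hbin_322050138 hbin_09510953 in \<open>unfold atLeastAtMost_iff, linarith\<close>)
  define g where "g = inv_into {l2..h2} hbin"
  have inj: "inj_on hbin {l2..h2}"
    using hbin_eq_iff by (auto intro!: inj_onI simp: defs)
  have contg: "continuous_on (hbin ` {l2..h2}) g"
    unfolding g_def using inj
    by (intro continuous_on_inv continuous_on_subset[OF continuous_on_hbin]) (auto simp: defs)
  have cont: "continuous_on {l2..h2} hbin"
    by (rule continuous_on_subset[OF continuous_on_hbin]) (auto simp: defs)
  have img: "2 * hbin s \<in> hbin ` {l2..h2}" if "s \<in> {l1..h1}" for s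
  proof -
    have "hbin l1 \<le> hbin s" "hbin s \<le> hbin h1"
      using that by (auto simp: hbin_le_iff defs)
    then have "hbin l2 \<le> 2 * hbin s" "2 * hbin s \<le> hbin h2" using num1 num4 by auto
    then obtain x where "l2 \<le> x" "x \<le> h2" "hbin x = 2 * hbin s"
      using IVT'[of hbin l2 "2 * hbin s" h2, OF _ _ _ cont] by (auto simp: defs)
    then show ?thesis by (metis atLeastAtMost_iff imageI)
  qed
  have g: "g (2 * hbin s) \<in> {l2..h2}" "hbin (g (2 * hbin s)) = 2 * hbin s" if "s \<in> {l1..h1}" for s
    using inv_into_into[OF img[OF that]] f_inv_into_f[OF img[OF that]] by (simp_all add: g_def)
  define D where "D = (\<lambda>s. 2 * hbin s - hbin ((1 - (s + g (2 * hbin s) - 2 * s * g (2 * hbin s))) / 2))"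
  have contgs: "continuous_on {l1..h1} (\<lambda>s. g (2 * hbin s))"
    using img
    by (intro continuous_on_compose2[OF contg] continuous_intros
        continuous_on_subset[OF continuous_on_hbin]) (auto simp: defs)
  have range: "(1 - (s + g (2 * hbin s) - 2 * s * g (2 * hbin s))) / 2 \<in> {0..1/2}" if "s \<in> {l1..h1}" for s
    using conv_bounds[of s "g (2 * hbin s)"] g(1)[OF that] that by (auto simp: defs)
  have "continuous_on {l1..h1} D"
    unfolding D_def using range
    by (intro continuous_intros continuous_on_compose2[OF continuous_on_hbin] contgs
        continuous_on_subset[OF continuous_on_hbin]) (force simp: defs)+
  \<comment> \<open>An upper bound \<open>d\<close> for \<open>s2\<close> gives an upper bound for
    \<open>f\<close> and so a lower bound for \<open>(1 - f) / 2\<close>; 6441/20000 is that bound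
    rounded down. At \<open>h1\<close> all directions are reversed.\<close>
  moreover have "D l1 \<le> 0"
  proof -
    have m: "l1 \<in> {l1..h1}" by (simp add: defs)
    have "g (2 * hbin l1) \<le> d"
      using num2 g[OF m] hbin_le_iff[of "g (2 * hbin l1)" d] by (auto simp: defs)
    then have "l1 + g (2 * hbin l1) - 2 * l1 * g (2 * hbin l1) \<le> l1 + d - 2 * l1 * d"
      using g(1)[OF m] by (intro conv_mono) (auto simp: defs)
    moreover have "6441/20000 \<le> (1 - (l1 + d - 2 * l1 * d)) / 2" by (simp add: defs)
    ultimately have "hbin (6441/20000) \<le> hbin ((1 - (l1 + g (2 * hbin l1) - 2 * l1 * g (2 * hbin l1))) / 2)"
      using range[OF m] by (subst hbin_le_iff) auto
    with num3 show ?thesis by (simp add: D_def)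
  qed
  moreover have "0 \<le> D h1"
  proof -
    have m: "h1 \<in> {l1..h1}" by (simp add: defs)
    have "d' \<le> g (2 * hbin h1)"
      using num5 g[OF m] hbin_le_iff[of d' "g (2 * hbin h1)"] by (auto simp: defs)
    then have "h1 + d' - 2 * h1 * d' \<le> h1 + g (2 * hbin h1) - 2 * h1 * g (2 * hbin h1)"
      using g(1)[OF m] by (intro conv_mono) (auto simp: defs)
    moreover have "(1 - (h1 + d' - 2 * h1 * d')) / 2 \<le> 161025069/500000000" by (simp add: defs)
    ultimately have "hbin ((1 - (h1 + g (2 * hbin h1) - 2 * h1 * g (2 * hbin h1))) / 2) \<le> hbin (161025069/500000000)"
      using range[OF m] by (subst hbin_le_iff) auto
    with num6 show ?thesis by (simp add: D_def)
  qed
  ultimately obtain s where s: "s \<in> {l1..h1}" "D s = 0"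
    using IVT'[of D l1 0 h1] by (auto simp: defs)
  show thesis
    by (rule that[of s "g (2 * hbin s)"]) (use s g[OF s(1)] in \<open>auto simp: D_def l1_def h1_def l2_def h2_def\<close>)
qed

section \<open>Single-letter information quantities\<close>

lemma pair_measure_count_space_UNIV:
  "count_space (UNIV :: 'a::countable set) \<Otimes>\<^sub>M count_space (UNIV :: 'b::countable set) = count_space UNIV"
  by (simp add: pair_measure_countable)

lemma sigma_finite_count_space_UNIV: "sigma_finite_measure (count_space (UNIV :: 'a::countable set))"
  by (rule sigma_finite_measure_count_space_countable) simp

text \<open>Probability mass functions are densities for the counting measure, so the density
  formulas for information quantities apply.\<close>

lemma distributed_pmf:
  "distributed (measure_pmf J) (count_space UNIV) X (\<lambda>x. ennreal (pmf (map_pmf X J) x))"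
  by (simp add: distributed_def map_pmf_rep_eq[symmetric] measure_pmf_eq_density[symmetric])

lemma integral_count_space_UNIV_eq_sum:
  fixes f :: "'a \<Rightarrow> real"
  assumes "finite A" "\<And>x. x \<notin> A \<Longrightarrow> f x = 0"
  shows "(\<integral>x. f x \<partial>count_space UNIV) = sum f A"
proof -
  have sub: "{x \<in> UNIV. f x \<noteq> 0} \<subseteq> A" using assms by auto
  have "(\<integral>x. f x \<partial>count_space UNIV) = sum f {x \<in> UNIV. f x \<noteq> 0}"
    using finite_subset[OF sub assms(1)] by (rule lebesgue_integral_count_space_finite_support)
  also have "\<dots> = sum f A"
    using sub assms by (intro sum.mono_neutral_left) auto
  finally show ?thesis .
qed

lemma information_space_pmf: "information_space (measure_pmf J) 2"
  by unfold_locales auto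

lemma mut_inf_eq:
  fixes X :: "'s \<Rightarrow> 'a::countable" and Y :: "'s \<Rightarrow> 'b::countable"
  assumes A: "finite A" "set_pmf (map_pmf (\<lambda>\<omega>. (X \<omega>, Y \<omega>)) J) \<subseteq> A"
  shows "mut_inf J X Y = (\<Sum>(x, y)\<in>A. pmf (map_pmf (\<lambda>\<omega>. (X \<omega>, Y \<omega>)) J) (x, y) *
    log 2 (pmf (map_pmf (\<lambda>\<omega>. (X \<omega>, Y \<omega>)) J) (x, y) / (pmf (map_pmf X J) x * pmf (map_pmf Y J) y)))"
proof -
  interpret information_space "measure_pmf J" 2 by (rule information_space_pmf)
  have null: "pmf (map_pmf (\<lambda>\<omega>. (X \<omega>, Y \<omega>)) J) x = 0" if "x \<notin> A" for x
    using A(2) that by (metis pmf_eq_0_set_pmf subsetD)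
  have "mut_inf J X Y = (\<integral>x. pmf (map_pmf (\<lambda>\<omega>. (X \<omega>, Y \<omega>)) J) x *
      log 2 (pmf (map_pmf (\<lambda>\<omega>. (X \<omega>, Y \<omega>)) J) x / (pmf (map_pmf X J) (fst x) * pmf (map_pmf Y J) (snd x)))
      \<partial>(count_space UNIV \<Otimes>\<^sub>M count_space UNIV))"
    unfolding mut_inf_def
    by (intro mutual_information_distr sigma_finite_count_space_UNIV distributed_pmf)
      (simp_all add: pair_measure_count_space_UNIV distributed_pmf)
  also have "\<dots> = (\<Sum>x\<in>A. pmf (map_pmf (\<lambda>\<omega>. (X \<omega>, Y \<omega>)) J) x *
      log 2 (pmf (map_pmf (\<lambda>\<omega>. (X \<omega>, Y \<omega>)) J) x / (pmf (map_pmf X J) (fst x) * pmf (map_pmf Y J) (snd x))))"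
    unfolding pair_measure_count_space_UNIV using A
    by (intro integral_count_space_UNIV_eq_sum) (auto simp: null simp del: pmf_eq_0_set_pmf)
  finally show ?thesis by (simp add: case_prod_beta)
qed

lemma cond_ent_eq:
  fixes X :: "'s \<Rightarrow> 'a::countable" and Z :: "'s \<Rightarrow> 'b::countable"
  assumes A: "finite A" "set_pmf (map_pmf (\<lambda>\<omega>. (X \<omega>, Z \<omega>)) J) \<subseteq> A"
  shows "cond_ent J X Z = - (\<Sum>(x, z)\<in>A. pmf (map_pmf (\<lambda>\<omega>. (X \<omega>, Z \<omega>)) J) (x, z) *
    log 2 (pmf (map_pmf (\<lambda>\<omega>. (X \<omega>, Z \<omega>)) J) (x, z) / pmf (map_pmf Z J) z))"
proof -
  interpret information_space "measure_pmf J" 2 by (rule information_space_pmf)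
  have null: "pmf (map_pmf (\<lambda>\<omega>. (X \<omega>, Z \<omega>)) J) x = 0" if "x \<notin> A" for x
    using A(2) that by (metis pmf_eq_0_set_pmf subsetD)
  have "cond_ent J X Z = - (\<integral>(x, z). pmf (map_pmf (\<lambda>\<omega>. (X \<omega>, Z \<omega>)) J) (x, z) *
      log 2 (pmf (map_pmf (\<lambda>\<omega>. (X \<omega>, Z \<omega>)) J) (x, z) / pmf (map_pmf Z J) z)
      \<partial>(count_space UNIV \<Otimes>\<^sub>M count_space UNIV))"
    unfolding cond_ent_def
    by (intro conditional_entropy_generic_eq sigma_finite_count_space_UNIV distributed_pmf)
      (simp_all add: pair_measure_count_space_UNIV distributed_pmf)
  also have "\<dots> = - (\<Sum>(x, z)\<in>A. pmf (map_pmf (\<lambda>\<omega>. (X \<omega>, Z \<omega>)) J) (x, z) *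
      log 2 (pmf (map_pmf (\<lambda>\<omega>. (X \<omega>, Z \<omega>)) J) (x, z) / pmf (map_pmf Z J) z))"
    unfolding pair_measure_count_space_UNIV using A
    by (intro arg_cong[where f = uminus] integral_count_space_UNIV_eq_sum) (auto simp: null simp del: pmf_eq_0_set_pmf)
  finally show ?thesis .
qed

text \<open>The chain rule, which is the definition of the conditional quantity; the order of the
  pair is the one in that definition.\<close>

lemma cond_mut_inf_eq:
  fixes X :: "'s \<Rightarrow> 'a::countable" and Y :: "'s \<Rightarrow> 'b::countable" and Z :: "'s \<Rightarrow> 'c::countable"
  shows "cond_mut_inf J X Y Z = mut_inf J X (\<lambda>\<omega>. (Y \<omega>, Z \<omega>)) - mut_inf J X Z"
  by (simp add: cond_mut_inf_def mut_inf_def prob_space.conditional_mutual_information_def[OF measure_pmf.prob_space_axioms]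
      pair_measure_count_space_UNIV)

lemma mut_inf_map:
  fixes X :: "'a \<Rightarrow> 'b::countable" and Y :: "'a \<Rightarrow> 'c::countable"
  shows "mut_inf J (\<lambda>\<omega>. X (g \<omega>)) (\<lambda>\<omega>. Y (g \<omega>)) = mut_inf (map_pmf g J) X Y"
  unfolding mut_inf_def prob_space.mutual_information_def[OF measure_pmf.prob_space_axioms]
  unfolding map_pmf_rep_eq by (simp add: distr_distr pair_measure_count_space_UNIV comp_def)

lemma pmf_map_eq_sum:
  assumes "finite S" "set_pmf J \<subseteq> S"
  shows "pmf (map_pmf g J) v = (\<Sum>\<omega>\<in>S. of_bool (g \<omega> = v) * pmf J \<omega>)"
proof -
  have "pmf (map_pmf g J) v = measure_pmf.prob J (g -` {v})" by (rule pmf_map)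
  also have "\<dots> = measure_pmf.prob J (g -` {v} \<inter> S)"
    using assms(2) by (intro measure_prob_cong_0) (auto simp: set_pmf_iff)
  also have "\<dots> = sum (pmf J) (g -` {v} \<inter> S)"
    using assms(1) by (intro measure_measure_pmf_finite) auto
  also have "g -` {v} \<inter> S = {\<omega> \<in> S. g \<omega> = v}" by auto
  finally show ?thesis using assms(1) by (simp add: sum.inter_filter of_bool_def if_distrib[of "\<lambda>c. c * _"] cong: if_cong)
qed

lemma pmf_bool_True: "pmf r True = 1 - pmf r False"
proof -
  have "sum (pmf r) UNIV = 1" by (rule sum_pmf_eq_1) auto
  then show ?thesis by (simp add: UNIV_bool)
qed

lemma pmf_bind_pair: "pmf (bind_pmf p (\<lambda>t. map_pmf (\<lambda>x. (x, t)) (q t))) (x, t) = pmf p t * pmf (q t) x"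
proof -
  have "pmf (map_pmf (\<lambda>x. (x, t')) (q t')) (x, t) = indicator {t} t' * pmf (q t) x" for t'
  proof (cases "t' = t")
    case True
    then show ?thesis by (simp add: pmf_map_inj'[where f = "\<lambda>x. (x, t)"] inj_on_def)
  next
    case False
    then show ?thesis by (auto simp: pmf_eq_0_set_pmf)
  qed
  then show ?thesis by (simp add: pmf_bind measure_pmf_single)
qed

lemma cond_ent_bool_eq:
  fixes X :: "'s \<Rightarrow> bool" and Z :: "'s \<Rightarrow> 'c::countable"
  assumes law: "map_pmf (\<lambda>\<omega>. (X \<omega>, Z \<omega>)) J = bind_pmf p (\<lambda>t. map_pmf (\<lambda>x. (x, t)) (q t))"
    and fin: "finite (set_pmf p)"
  shows "cond_ent J X Z = (\<Sum>t\<in>set_pmf p. pmf p t * hbin (pmf (q t) False))"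
proof -
  have "map_pmf Z J = map_pmf snd (map_pmf (\<lambda>\<omega>. (X \<omega>, Z \<omega>)) J)"
    by (simp add: map_pmf_comp)
  also have "\<dots> = p"
    unfolding law by (simp add: map_bind_pmf map_pmf_comp map_pmf_const bind_return_pmf')
  finally have Z: "map_pmf Z J = p" .
  have "set_pmf (map_pmf (\<lambda>\<omega>. (X \<omega>, Z \<omega>)) J) \<subseteq> UNIV \<times> set_pmf p"
    unfolding law by auto
  then have "cond_ent J X Z = - (\<Sum>(x, t)\<in>UNIV \<times> set_pmf p. pmf p t * pmf (q t) x * log 2 (pmf p t * pmf (q t) x / pmf p t))"
    using cond_ent_eq[of "UNIV \<times> set_pmf p" X Z J] fin by (simp add: law Z pmf_bind_pair)
  also have "(\<Sum>(x, t)\<in>UNIV \<times> set_pmf p. pmf p t * pmf (q t) x * log 2 (pmf p t * pmf (q t) x / pmf p t))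
      = (\<Sum>t\<in>set_pmf p. \<Sum>x\<in>UNIV. pmf p t * pmf (q t) x * log 2 (pmf p t * pmf (q t) x / pmf p t))"
    by (subst sum.swap) (rule sum.cartesian_product[symmetric])
  also have "\<dots> = (\<Sum>t\<in>set_pmf p. - (pmf p t * hbin (pmf (q t) False)))"
    by (intro sum.cong refl) (simp add: UNIV_bool set_pmf_iff hbin_def pmf_bool_True algebra_simps)
  finally show ?thesis by (simp add: sum_negf)
qed

section \<open>Information quantities of the noisy adder\<close>

lemma pmf_noisy_adder:
  "pmf (noisy_adder x1 x2) y = (if y = of_bool x1 + of_bool x2 \<or> y = Suc (of_bool x1 + of_bool x2) then 1/2 else 0)"
proof -
  have "pmf (noisy_adder x1 x2) y
    = (\<Sum>z\<in>{0, 1}. of_bool (of_bool x1 + of_bool x2 + z = y) * pmf (pmf_of_set {0, 1}) z)"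
    unfolding noisy_adder_def by (rule pmf_map_eq_sum) auto
  then show ?thesis by auto
qed

text \<open>Gibbs' inequality, stated for general finite sums because it serves both a single output
  and whole output strings.\<close>

lemma entropy_le_cross_entropy:
  assumes "finite A" "\<And>x. x \<in> A \<Longrightarrow> 0 \<le> p x" "\<And>x. x \<in> A \<Longrightarrow> 0 < q x" "sum q A \<le> sum p A"
  shows "- (\<Sum>x\<in>A. p x * log 2 (p x)) \<le> - (\<Sum>x\<in>A. p x * log 2 (q x))"
proof -
  have "(\<Sum>x\<in>A. p x * (ln (q x) - ln (p x))) \<le> (\<Sum>x\<in>A. q x - p x)"
    using assms by (intro sum_mono mult_ln_diff_le) auto
  also have "\<dots> \<le> 0" using assms by (simp add: sum_subtractf)
  finally have "(\<Sum>x\<in>A. p x * (ln (q x) - ln (p x))) / ln 2 \<le> 0"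
    by (simp add: divide_nonpos_pos)
  also have "(\<Sum>x\<in>A. p x * (ln (q x) - ln (p x))) / ln 2 = (\<Sum>x\<in>A. p x * log 2 (q x) - p x * log 2 (p x))"
    unfolding sum_divide_distrib by (intro sum.cong) (auto simp: log_def diff_divide_distrib right_diff_distrib)
  finally show ?thesis by (simp add: sum_subtractf)
qed

text \<open>The two mutual informations do not mention \<open>T\<close>, so they depend on the
  distribution only through this averaged law of the inputs. It need not be a product.\<close>

definition input_law :: "'t pmf \<Rightarrow> ('t \<Rightarrow> bool pmf) \<Rightarrow> ('t \<Rightarrow> bool pmf) \<Rightarrow> (bool \<times> bool) pmf" where
  "input_law pT q1 q2 = bind_pmf pT (\<lambda>t. pair_pmf (q1 t) (q2 t))"

definition io_law :: "(bool \<times> bool) pmf \<Rightarrow> (bool \<times> bool \<times> nat) pmf" where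
  "io_law P = bind_pmf P (\<lambda>(x1, x2). map_pmf (\<lambda>y. (x1, x2, y)) (noisy_adder x1 x2))"

lemma map_joint_law:
  "map_pmf (\<lambda>(t, x1, x2, y). (x1, x2, y)) (joint_law noisy_adder pT q1 q2) = io_law (input_law pT q1 q2)"
  by (simp add: joint_law_def io_law_def input_law_def pair_pmf_def bind_assoc_pmf
      bind_return_pmf map_pmf_def)

lemma map_joint_law_X1_T:
  "map_pmf (\<lambda>\<omega>. ((\<lambda>(t, x1, x2, y). x1) \<omega>, (\<lambda>(t, x1, x2, y). t) \<omega>)) (joint_law W pT q1 q2)
    = bind_pmf pT (\<lambda>t. map_pmf (\<lambda>x. (x, t)) (q1 t))"
  by (simp add: joint_law_def map_pmf_def bind_assoc_pmf bind_return_pmf)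

lemma map_joint_law_X2_T:
  "map_pmf (\<lambda>\<omega>. ((\<lambda>(t, x1, x2, y). x2) \<omega>, (\<lambda>(t, x1, x2, y). t) \<omega>)) (joint_law W pT q1 q2)
    = bind_pmf pT (\<lambda>t. map_pmf (\<lambda>x. (x, t)) (q2 t))"
  by (simp add: joint_law_def map_pmf_def bind_assoc_pmf bind_return_pmf)

lemma pmf_io_law: "pmf (io_law P) (x1, x2, y) = pmf P (x1, x2) * pmf (noisy_adder x1 x2) y"
proof -
  have "pmf (case a of (x1, x2) \<Rightarrow> map_pmf (\<lambda>y. (x1, x2, y)) (noisy_adder x1 x2)) (x1, x2, y)
      = indicator {(x1, x2)} a * pmf (noisy_adder x1 x2) y" for a
  proof (cases "a = (x1, x2)")
    case True
    then show ?thesis by (simp add: pmf_map_inj'[where f = "\<lambda>y. (x1, x2, y)"] inj_on_def)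
  next
    case False
    then show ?thesis by (auto simp: pmf_eq_0_set_pmf split: prod.splits)
  qed
  then show ?thesis by (simp add: io_law_def pmf_bind measure_pmf_single)
qed

lemma set_io_law:
  "set_pmf (io_law P) \<subseteq> {(False, False, 0), (False, False, 1), (False, True, 1), (False, True, 2),
    (True, False, 1), (True, False, 2), (True, True, 2), (True, True, 3)}"
proof
  fix \<omega> assume \<omega>: "\<omega> \<in> set_pmf (io_law P)"
  obtain x1 x2 y where xy: "\<omega> = (x1, x2, y)" by (cases \<omega>)
  have "pmf (noisy_adder x1 x2) y \<noteq> 0"
    using \<omega> by (auto simp: set_pmf_iff pmf_io_law xy)
  then show "\<omega> \<in> {(False, False, 0), (False, False, 1), (False, True, 1), (False, True, 2),
    (True, False, 1), (True, False, 2), (True, True, 2), (True, True, 3)}"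
    unfolding xy by (cases x1; cases x2) (auto simp: pmf_noisy_adder split: if_splits)
qed

lemma pmf_map_io_law:
  fixes P defines "a \<equiv> pmf P (False, False)" and "b \<equiv> pmf P (False, True)"
    and "c \<equiv> pmf P (True, False)" and "d \<equiv> pmf P (True, True)"
  shows "pmf (map_pmf g (io_law P)) v =
     of_bool (g (False, False, 0) = v) * (a / 2) + of_bool (g (False, False, 1) = v) * (a / 2) +
     of_bool (g (False, True, 1) = v) * (b / 2) + of_bool (g (False, True, 2) = v) * (b / 2) +
     of_bool (g (True, False, 1) = v) * (c / 2) + of_bool (g (True, False, 2) = v) * (c / 2) +
     of_bool (g (True, True, 2) = v) * (d / 2) + of_bool (g (True, True, 3) = v) * (d / 2)"
  unfolding assms by (subst pmf_map_eq_sum[OF _ set_io_law]) (simp_all add: pmf_io_law pmf_noisy_adder)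

lemma set_map_io_law:
  "set_pmf (map_pmf g (io_law P)) \<subseteq> g ` {(False, False, 0), (False, False, 1), (False, True, 1), (False, True, 2),
    (True, False, 1), (True, False, 2), (True, True, 2), (True, True, 3)}"
  unfolding set_map_pmf by (rule image_mono[OF set_io_law])

lemma sum_pmf_bool_pair:
  "pmf P (False, False) + pmf P (False, True) + pmf P (True, False) + pmf P (True, True) = 1"
proof -
  have "(UNIV :: (bool \<times> bool) set) = {(False, False), (False, True), (True, False), (True, True)}"
    unfolding UNIV_Times_UNIV[symmetric] UNIV_bool by auto
  moreover have "sum (pmf P) UNIV = 1"
    by (rule sum_pmf_eq_1) auto
  ultimately have "sum (pmf P) {(False, False), (False, True), (True, False), (True, True)} = 1"
    by (simp only:)
  then show ?thesis by simp
qed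

text \<open>One term of the mutual information: an input pair of probability \<open>a\<close> yields
  each of its two outputs with probability 1/2, and \<open>p\<close> is the probability of the
  output. The summand \<open>- (a / 2)\<close> collects the noise entropy.\<close>

lemma half_log_aux:
  assumes "0 \<le> a" "0 < a \<Longrightarrow> 0 < p"
  shows "a / 2 * log 2 ((a / 2) / (a * p)) = - (a / 2) - a / 2 * log 2 (p :: real)"
proof (cases "a = 0")
  case False
  with assms have "0 < a" "0 < p" by auto
  then have "(a / 2) / (a * p) = inverse (2 * p)" by (simp add: field_simps)
  moreover have "log 2 (inverse (2 * p)) = - 1 - log 2 p"
    using \<open>0 < p\<close> by (subst log_inverse) (auto simp: log_mult)
  ultimately have "log 2 ((a / 2) / (a * p)) = - 1 - log 2 p" by (simp only:)
  then show ?thesis by (simp add: right_diff_distrib)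
qed simp

text \<open>Given both inputs, the output carries exactly the one bit of noise; the formula is
  \<open>H(Y) - 1\<close>.\<close>

lemma mut_inf_inputs_output:
  fixes P defines "a \<equiv> pmf P (False, False)" and "b \<equiv> pmf P (False, True)"
    and "c \<equiv> pmf P (True, False)" and "d \<equiv> pmf P (True, True)"
  shows "mut_inf (io_law P) (\<lambda>(x1, x2, y). (x1, x2)) (\<lambda>(x1, x2, y). y) =
    - (a / 2 * log 2 (a / 2) + (a + b + c) / 2 * log 2 ((a + b + c) / 2)
      + (b + c + d) / 2 * log 2 ((b + c + d) / 2) + d / 2 * log 2 (d / 2)) - 1"
proof -
  have nn: "0 \<le> a" "0 \<le> b" "0 \<le> c" "0 \<le> d" and total: "a + b + c + d = 1"
    using sum_pmf_bool_pair[of P] by (auto simp: assms)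
  let ?X = "\<lambda>(x1, x2, y). (x1, x2) :: bool \<times> bool" and ?Y = "\<lambda>(x1 :: bool, x2 :: bool, y). y :: nat"
  note law = pmf_map_io_law[of _ P, folded a_def b_def c_def d_def]
  have "mut_inf (io_law P) ?X ?Y =
     a / 2 * log 2 ((a / 2) / (a * (a / 2))) + a / 2 * log 2 ((a / 2) / (a * ((a + b + c) / 2))) +
     b / 2 * log 2 ((b / 2) / (b * ((a + b + c) / 2))) + b / 2 * log 2 ((b / 2) / (b * ((b + c + d) / 2))) +
     c / 2 * log 2 ((c / 2) / (c * ((a + b + c) / 2))) + c / 2 * log 2 ((c / 2) / (c * ((b + c + d) / 2))) +
     d / 2 * log 2 ((d / 2) / (d * ((b + c + d) / 2))) + d / 2 * log 2 ((d / 2) / (d * (d / 2)))"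
    by (subst mut_inf_eq[OF _ set_map_io_law], simp)
      (simp add: law add_divide_distrib)
  also have "\<dots> = - (a / 2 * log 2 (a / 2) + (a + b + c) / 2 * log 2 ((a + b + c) / 2)
      + (b + c + d) / 2 * log 2 ((b + c + d) / 2) + d / 2 * log 2 (d / 2)) - (a + b + c + d)"
  proof -
    have aux: "u / 2 * log 2 ((u / 2) / (u * p)) = - (u / 2) - u / 2 * log 2 p" if "0 \<le> u" "u / 2 \<le> p" for u p
      using that by (intro half_log_aux) auto
    have ineqs: "a / 2 \<le> a / 2" "a / 2 \<le> (a + b + c) / 2" "b / 2 \<le> (a + b + c) / 2" "b / 2 \<le> (b + c + d) / 2"
      "c / 2 \<le> (a + b + c) / 2" "c / 2 \<le> (b + c + d) / 2" "d / 2 \<le> (b + c + d) / 2" "d / 2 \<le> d / 2"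
      using nn by auto
    show ?thesis
      unfolding aux[OF nn(1) ineqs(1)] aux[OF nn(1) ineqs(2)] aux[OF nn(2) ineqs(3)] aux[OF nn(2) ineqs(4)]
        aux[OF nn(3) ineqs(5)] aux[OF nn(3) ineqs(6)] aux[OF nn(4) ineqs(7)] aux[OF nn(4) ineqs(8)]
      by (simp add: algebra_simps add_divide_distrib)
  qed
  finally show ?thesis using total by simp
qed

text \<open>Given \<open>X2\<close>, the output reveals \<open>X1\<close> or tells nothing about it,
  each with probability 1/2. The value is therefore half of \<open>H(X1|X2)\<close>, and here
  \<open>X1\<close> differs from \<open>X2\<close> with probability \<open>f\<close> whatever
  \<open>X2\<close> is.\<close>

lemma cond_mut_inf_symmetric:
  assumes f: "0 < f" "f < 1"
    and P: "pmf P (False, False) = (1 - f) / 2" "pmf P (False, True) = f / 2"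
     "pmf P (True, False) = f / 2" "pmf P (True, True) = (1 - f) / 2"
  shows "mut_inf (io_law P) (\<lambda>(x1, x2, y). x1) (\<lambda>(x1, x2, y). (y, x2))
     - mut_inf (io_law P) (\<lambda>(x1, x2, y). x1) (\<lambda>(x1, x2, y). x2) = hbin f / 2"
proof -
  let ?X1 = "\<lambda>(x1, x2, y). x1 :: bool" and ?X2 = "\<lambda>(x1 :: bool, x2 :: bool, y :: nat). x2"
    and ?YX2 = "\<lambda>(x1 :: bool, x2, y). (y, x2) :: nat \<times> bool"
  define q where "q = 1 - f"
  have q: "0 < q" "q + f = 1" using f by (auto simp: q_def)
  have sums: "q / 2 + f / 2 = 1 / 2" "f / 2 + q / 2 = 1 / 2" "q \<noteq> 0" "f \<noteq> 0"
    using q f by auto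
  note law = pmf_map_io_law[of _ P, unfolded P, folded q_def]
  have "mut_inf (io_law P) ?X1 ?YX2 =
     2 * (q / 2 / 2 * log 2 (q / 2 / 2 / ((1 / 2) * (q / 2 / 2))) + q / 2 / 2 * log 2 (q / 2 / 2 / ((1 / 2) * (1 / 4)))
      + f / 2 / 2 * log 2 (f / 2 / 2 / ((1 / 2) * (1 / 4))) + f / 2 / 2 * log 2 (f / 2 / 2 / ((1 / 2) * (f / 2 / 2))))"
    by (subst mut_inf_eq[OF _ set_map_io_law], simp) (simp add: law sums mult.commute)
  moreover have "mut_inf (io_law P) ?X1 ?X2 =
     2 * ((q / 2 / 2 + q / 2 / 2) * log 2 ((q / 2 / 2 + q / 2 / 2) / (1 / 2 * (1 / 2)))
      + (f / 2 / 2 + f / 2 / 2) * log 2 ((f / 2 / 2 + f / 2 / 2) / (1 / 2 * (1 / 2))))"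
    by (subst mut_inf_eq[OF _ set_map_io_law], simp) (simp add: law sums mult.commute)
  moreover have "log 2 (q * 2) = 1 + log 2 q" "log 2 (f * 2) = 1 + log 2 f"
    using f q by (simp_all add: log_mult)
  ultimately show ?thesis
    using f q by (simp add: hbin_def field_simps flip: q_def)
qed

lemma cond_ent_X1_T:
  assumes "finite (set_pmf pT)"
  shows "cond_ent (joint_law W (pT :: nat pmf) q1 q2) (\<lambda>(t, x1, x2, y). x1) (\<lambda>(t, x1, x2, y). t)
    = (\<Sum>t\<in>set_pmf pT. pmf pT t * hbin (pmf (q1 t) False))"
  using map_joint_law_X1_T assms by (rule cond_ent_bool_eq)

lemma cond_ent_X2_T:
  assumes "finite (set_pmf pT)"
  shows "cond_ent (joint_law W (pT :: nat pmf) q1 q2) (\<lambda>(t, x1, x2, y). x2) (\<lambda>(t, x1, x2, y). t)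
    = (\<Sum>t\<in>set_pmf pT. pmf pT t * hbin (pmf (q2 t) False))"
  using map_joint_law_X2_T assms by (rule cond_ent_bool_eq)

lemma mut_inf_joint_law:
  "mut_inf (joint_law noisy_adder pT q1 q2)
      (\<lambda>\<omega>. ((\<lambda>(t, x1, x2, y). x1) \<omega>, (\<lambda>(t, x1, x2, y). x2) \<omega>)) (\<lambda>(t, x1, x2, y). y)
    = mut_inf (io_law (input_law pT q1 q2)) (\<lambda>(x1, x2, y). (x1, x2)) (\<lambda>(x1, x2, y). y)"
  unfolding map_joint_law[symmetric] mut_inf_map[symmetric] by (simp add: case_prod_beta')

lemma cond_mut_inf_joint_law:
  "cond_mut_inf (joint_law noisy_adder pT q1 q2)
      (\<lambda>(t, x1, x2, y). x1) (\<lambda>(t, x1, x2, y). y) (\<lambda>(t, x1, x2, y). x2)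
    = mut_inf (io_law (input_law pT q1 q2)) (\<lambda>(x1, x2, y). x1) (\<lambda>(x1, x2, y). (y, x2))
     - mut_inf (io_law (input_law pT q1 q2)) (\<lambda>(x1, x2, y). x1) (\<lambda>(x1, x2, y). x2)"
  unfolding map_joint_law[symmetric] mut_inf_map[symmetric] cond_mut_inf_eq by (simp add: case_prod_beta')

lemma pmf_input_law:
  assumes "finite (set_pmf pT)"
  shows "pmf (input_law pT q1 q2) (x1, x2) = (\<Sum>t\<in>set_pmf pT. pmf pT t * (pmf (q1 t) x1 * pmf (q2 t) x2))"
  unfolding input_law_def pmf_bind using assms
  by (subst integral_measure_pmf[of "set_pmf pT"]) (auto simp: pmf_pair)

text \<open>Replacing the output law by the symmetric one inside the logarithm leaves an expression
  affine in the probability \<open>b + c\<close> of unequal inputs, which is itself an average over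
  \<open>T\<close>.\<close>

lemma mut_inf_le_cross:
  assumes f: "0 < f" "f < 1" and fin: "finite (set_pmf pT)"
  shows "mut_inf (io_law (input_law pT q1 q2)) (\<lambda>(x1, x2, y). (x1, x2)) (\<lambda>(x1, x2, y). y)
    \<le> (\<Sum>t\<in>set_pmf pT. pmf pT t * cross f (pmf (q1 t) False) (pmf (q2 t) False))"
proof -
  define a b c d where "a = pmf (input_law pT q1 q2) (False, False)" and "b = pmf (input_law pT q1 q2) (False, True)"
    and "c = pmf (input_law pT q1 q2) (True, False)" and "d = pmf (input_law pT q1 q2) (True, True)"
  note abcd = a_def b_def c_def d_def
  have nn: "0 \<le> a" "0 \<le> b" "0 \<le> c" "0 \<le> d" and total: "a + b + c + d = 1"
    using sum_pmf_bool_pair[of "input_law pT q1 q2"] by (auto simp: abcd)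
  \<comment> \<open>The laws of the outputs 0 to 3: the actual one and the symmetric reference
    law.\<close>
  define p q where "p = (!) [a / 2, (a + b + c) / 2, (b + c + d) / 2, d / 2]"
    and "q = (!) [(1 - f) / 4, (1 + f) / 4, (1 + f) / 4, (1 - f) / 4]"
  have "- (\<Sum>i<4. p i * log 2 (p i)) \<le> - (\<Sum>i<4. p i * log 2 (q i))"
  proof (rule entropy_le_cross_entropy)
    show "sum q {..<4} \<le> sum p {..<4}"
      using total by (simp add: p_def q_def eval_nat_numeral field_simps)
  qed (use nn f in \<open>auto simp: p_def q_def eval_nat_numeral less_Suc_eq\<close>)
  then have "mut_inf (io_law (input_law pT q1 q2)) (\<lambda>(x1, x2, y). (x1, x2)) (\<lambda>(x1, x2, y). y) \<le>
    - (a / 2 * log 2 ((1 - f) / 4) + (a + b + c) / 2 * log 2 ((1 + f) / 4)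
      + (b + c + d) / 2 * log 2 ((1 + f) / 4) + d / 2 * log 2 ((1 - f) / 4)) - 1"
    unfolding mut_inf_inputs_output abcd[symmetric] by (simp add: p_def q_def eval_nat_numeral)
  also have "\<dots> = - (a + d) / 2 * log 2 ((1 - f) / 2) - (1 + (b + c)) / 2 * log 2 ((1 + f) / 2)"
  proof -
    have logs: "log 2 ((1 - f) / 4) = log 2 ((1 - f) / 2) - 1" "log 2 ((1 + f) / 4) = log 2 ((1 + f) / 2) - 1"
      using f log_divide[of 2 "(1 - f) / 2" 2] log_divide[of 2 "(1 + f) / 2" 2] by auto
    have d: "d = 1 - (a + b + c)" using total by simp
    show ?thesis unfolding logs d by (simp add: field_simps)
  qed
  also have "\<dots> = (\<Sum>t\<in>set_pmf pT. pmf pT t * cross f (pmf (q1 t) False) (pmf (q2 t) False))"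
  proof -
    have bc: "b + c = (\<Sum>t\<in>set_pmf pT. pmf pT t * (pmf (q1 t) False + pmf (q2 t) False - 2 * pmf (q1 t) False * pmf (q2 t) False))"
      unfolding abcd pmf_input_law[OF fin] sum.distrib[symmetric]
      by (intro sum.cong refl) (simp add: pmf_bool_True algebra_simps)
    have ad: "a + d = 1 - (b + c)" using total by simp
    have one: "(\<Sum>t\<in>set_pmf pT. pmf pT t) = 1" using fin by (simp add: sum_pmf_eq_1)
    have cross: "cross f x y = - (log 2 ((1 - f) / 2) + log 2 ((1 + f) / 2)) / 2
       + (x + y - 2 * x * y) * ((log 2 ((1 - f) / 2) - log 2 ((1 + f) / 2)) / 2)" for x y
      by (simp add: cross_def field_simps)
    have "(\<Sum>t\<in>set_pmf pT. pmf pT t * cross f (pmf (q1 t) False) (pmf (q2 t) False))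
      = (\<Sum>t\<in>set_pmf pT. pmf pT t) * (- (log 2 ((1 - f) / 2) + log 2 ((1 + f) / 2)) / 2)
        + (b + c) * ((log 2 ((1 - f) / 2) - log 2 ((1 + f) / 2)) / 2)"
      unfolding bc sum_distrib_right sum.distrib[symmetric] cross
      by (intro sum.cong refl) (simp only: distrib_left mult.assoc)
    then show ?thesis unfolding one ad by (simp add: field_simps)
  qed
  finally show ?thesis .
qed

section \<open>The converse for feedback codes\<close>

definition words :: "'a set \<Rightarrow> nat \<Rightarrow> 'a list set" where
  "words A n = {xs. set xs \<subseteq> A \<and> length xs = n}"

lemma finite_words: "finite A \<Longrightarrow> finite (words A n)"
  by (simp add: words_def finite_lists_length_eq)

lemma words_0: "words A 0 = {[]}"
  by (auto simp: words_def)

lemma sum_words_Suc: "(\<Sum>xs\<in>words A (Suc n). f xs) = (\<Sum>xs\<in>words A n. \<Sum>x\<in>A. f (x # xs))"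
proof -
  have "words A (Suc n) = (\<lambda>(xs, x). x # xs) ` (words A n \<times> A)"
    by (auto simp: words_def length_Suc_conv image_iff)
  moreover have "inj_on (\<lambda>(xs, x). x # xs) (words A n \<times> A)"
    by (auto simp: inj_on_def)
  ultimately show ?thesis
    by (simp add: sum.reindex sum.cartesian_product case_prod_beta')
qed

lemma sum_words_prod_list:
  fixes r :: "'a \<Rightarrow> real"
  shows "(\<Sum>xs\<in>words A n. prod_list (map r xs)) = sum r A ^ n"
  by (induction n) (simp_all add: words_0 sum_words_Suc flip: sum_distrib_right sum_distrib_left)

abbreviation adder_output :: "bool \<Rightarrow> bool \<Rightarrow> nat \<Rightarrow> bool" where
  "adder_output x1 x2 y \<equiv> y = of_bool x1 + of_bool x2 \<or> y = Suc (of_bool x1 + of_bool x2)"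

text \<open>Lists of past outputs, here and below, have the latest output first.\<close>

primrec consistent :: "(nat list \<Rightarrow> bool) \<Rightarrow> (nat list \<Rightarrow> bool) \<Rightarrow> nat list \<Rightarrow> bool" where
  "consistent g1 g2 [] \<longleftrightarrow> True"
| "consistent g1 g2 (y # ys) \<longleftrightarrow> consistent g1 g2 ys \<and> adder_output (g1 (rev ys)) (g2 (rev ys)) y"

text \<open>Each channel use has two equally likely outputs, so all possible output strings of a
  message pair have the same probability. This makes the posterior law of the messages
  uniform.\<close>

lemma pmf_outputs:
  "pmf (outputs noisy_adder g1 g2 (length ys)) (rev ys) = of_bool (consistent g1 g2 ys) / 2 ^ length ys"
proof (induction ys)
  case (Cons y ys)
  have "pmf (bind_pmf (noisy_adder (g1 zs) (g2 zs)) (\<lambda>y. return_pmf (zs @ [y]))) (rev ys @ [y])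
      = indicator {rev ys} zs * pmf (noisy_adder (g1 (rev ys)) (g2 (rev ys))) y" for zs
  proof (cases "zs = rev ys")
    case True
    then show ?thesis
      unfolding map_pmf_def[symmetric] by (simp add: pmf_map_inj'[where f = "\<lambda>y. rev ys @ [y]"] inj_on_def)
  next
    case False
    then show ?thesis by (auto simp: pmf_eq_0_set_pmf)
  qed
  then have "pmf (outputs noisy_adder g1 g2 (Suc (length ys))) (rev ys @ [y])
     = pmf (outputs noisy_adder g1 g2 (length ys)) (rev ys) * pmf (noisy_adder (g1 (rev ys)) (g2 (rev ys))) y"
    by (simp add: pmf_bind measure_pmf_single)
  then show ?case by (simp add: Cons.IH pmf_noisy_adder)
qed simp

lemma set_outputs: "set_pmf (outputs noisy_adder g1 g2 n) \<subseteq> rev ` words {0, 1, 2, 3} n"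
proof (induction n)
  case (Suc n)
  show ?case
  proof
    fix xs assume "xs \<in> set_pmf (outputs noisy_adder g1 g2 (Suc n))"
    then obtain ys y where ys: "ys \<in> set_pmf (outputs noisy_adder g1 g2 n)" "xs = ys @ [y]"
      "y \<in> set_pmf (noisy_adder (g1 ys) (g2 ys))" by auto
    from ys(3) have "y \<in> {0, 1, 2, 3}" using set_pmf_noisy_adder by blast
    moreover from ys(1) Suc.IH obtain zs where "zs \<in> words {0, 1, 2, 3} n" "ys = rev zs" by auto
    ultimately show "xs \<in> rev ` words {0, 1, 2, 3} (Suc n)"
      unfolding ys(2) by (intro image_eqI[of _ _ "y # zs"]) (auto simp: words_def)
  qed
qed (simp add: words_0)

lemma prob_outputs:
  "measure_pmf.prob (outputs noisy_adder g1 g2 n) S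
    = (\<Sum>ys\<in>words {0, 1, 2, 3} n. of_bool (rev ys \<in> S) * of_bool (consistent g1 g2 ys)) / 2 ^ n"
proof -
  let ?p = "outputs noisy_adder g1 g2 n" and ?W = "words {0, 1, 2, 3 :: nat} n"
  have "measure_pmf.prob ?p S = pmf (map_pmf (\<lambda>x. x \<in> S) ?p) True"
    by (simp add: pmf_map vimage_def)
  also have "\<dots> = (\<Sum>xs\<in>rev ` ?W. of_bool ((xs \<in> S) = True) * pmf ?p xs)"
    by (intro pmf_map_eq_sum set_outputs finite_imageI finite_words) auto
  also have "\<dots> = (\<Sum>ys\<in>?W. of_bool (rev ys \<in> S) * pmf ?p (rev ys))"
    by (subst sum.reindex) (auto simp: inj_on_def)
  also have "\<dots> = (\<Sum>ys\<in>?W. of_bool (rev ys \<in> S) * (of_bool (consistent g1 g2 ys) / 2 ^ n))"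
    by (intro sum.cong refl) (auto simp: words_def pmf_outputs)
  finally show ?thesis by (simp add: sum_divide_distrib)
qed

text \<open>Multiplication by the numbers of messages cancels the uniform priors and leaves a count
  of correctly decoded triples. The reversal is due to \<open>ys\<close> having the latest output
  first.\<close>

lemma error_prob_eq:
  assumes M: "msgs1 C \<ge> 1" "msgs2 C \<ge> 1"
  shows "real (msgs1 C) * real (msgs2 C) * (1 - error_prob noisy_adder n C) =
    (\<Sum>w1\<in>{1..msgs1 C}. \<Sum>w2\<in>{1..msgs2 C}. \<Sum>ys\<in>words {0, 1, 2, 3} n.
      of_bool (dec C (rev ys) = (w1, w2)) * of_bool (consistent (enc1 C w1) (enc2 C w2) ys)) / 2 ^ n"
proof -
  have "1 - error_prob noisy_adder n C = measure_pmf.prob (transmission noisy_adder n C) {(w, ys). dec C ys = w}"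
    unfolding error_prob_def
    by (subst measure_pmf.prob_compl[symmetric]) (auto intro!: arg_cong[where f = "measure_pmf.prob _"])
  also have "\<dots> = (\<Sum>w1\<in>{1..msgs1 C}. (\<Sum>w2\<in>{1..msgs2 C}.
      measure_pmf.prob (outputs noisy_adder (enc1 C w1) (enc2 C w2) n) {ys. dec C ys = (w1, w2)}) / msgs2 C) / msgs1 C"
  proof -
    have prob_bind: "measure_pmf.prob (bind_pmf p f) S = (\<integral>x. measure_pmf.prob (f x) S \<partial>measure_pmf p)"
      for p :: "'x pmf" and f :: "'x \<Rightarrow> 'y pmf" and S
    proof -
      have "measure_pmf.prob (bind_pmf p f) S = pmf (map_pmf (\<lambda>x. x \<in> S) (bind_pmf p f)) True"
        by (simp add: pmf_map vimage_def)
      also have "\<dots> = (\<integral>x. pmf (map_pmf (\<lambda>y. y \<in> S) (f x)) True \<partial>measure_pmf p)"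
        unfolding map_bind_pmf pmf_bind ..
      finally show ?thesis by (simp add: pmf_map vimage_def)
    qed
    have indicator: "measure_pmf.expectation p (\<lambda>ys. indicat_real {(w, ys). dec C ys = w} (w, ys))
        = measure_pmf.prob p {ys. dec C ys = w}" for p w
    proof -
      have "(\<lambda>ys. indicat_real {(w, ys). dec C ys = w} (w, ys)) = indicator {ys. dec C ys = w}"
        by (auto simp: indicator_def)
      then show ?thesis by simp
    qed
    show ?thesis
      unfolding transmission_def prob_bind using M
      by (simp add: integral_pmf_of_set indicator flip: sum_divide_distrib)
  qed
  finally have "real (msgs1 C) * real (msgs2 C) * (1 - error_prob noisy_adder n C)
     = (\<Sum>w1\<in>{1..msgs1 C}. \<Sum>w2\<in>{1..msgs2 C}.
      measure_pmf.prob (outputs noisy_adder (enc1 C w1) (enc2 C w2) n) {ys. dec C ys = (w1, w2)})"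
    using M by (simp flip: sum_divide_distrib)
  then show ?thesis by (simp add: prob_outputs sum_divide_distrib)
qed

text \<open>The grouping rule for entropy without normalisation: a set of \<open>u + v\<close>
  candidates is split into two blocks. Empty blocks are covered by
  \<open>log 2 0 = 0\<close>.\<close>

lemma log_split:
  fixes u v :: real
  assumes "0 \<le> u" "0 \<le> v"
  shows "u * log 2 u + v * log 2 v = (u + v) * (log 2 (u + v) - hbin (u / (u + v)))"
proof (cases "u = 0 \<or> v = 0")
  case False
  with assms have uv: "u > 0" "v > 0" by auto
  have "1 - u / (u + v) = v / (u + v)" using uv by (simp add: field_simps)
  then have "hbin (u / (u + v)) = - (u / (u + v)) * (log 2 u - log 2 (u + v)) - (v / (u + v)) * (log 2 v - log 2 (u + v))"
    using uv by (simp add: hbin_def log_divide)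
  moreover have "(u + v) * (u / (u + v)) = u" "(u + v) * (v / (u + v)) = v" using uv by auto
  moreover have "(u + v) * (- (u / (u + v)) * x - (v / (u + v)) * y) = - ((u + v) * (u / (u + v))) * x - ((u + v) * (v / (u + v))) * y" for x y
    by (simp only: right_diff_distrib mult_minus_right mult_minus_left mult.assoc)
  ultimately have "(u + v) * hbin (u / (u + v)) = - u * (log 2 u - log 2 (u + v)) - v * (log 2 v - log 2 (u + v))"
    by (simp only:)
  then show ?thesis by (simp add: algebra_simps)
qed (auto simp: hbin_def)

text \<open>A transcript records the inputs of the first user together with the outputs. Given a transcript,
  the messages of the two users are independent, each one uniform on the set of messages
  that are consistent with the transcript.\<close>

context
  fixes e1 e2 :: "nat \<Rightarrow> nat list \<Rightarrow> bool" and M1 M2 :: nat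
begin

abbreviation transcripts :: "nat \<Rightarrow> (bool \<times> nat) list set" where
  "transcripts \<equiv> words (UNIV \<times> {0, 1, 2, 3})"

primrec post1 :: "(bool \<times> nat) list \<Rightarrow> nat set" where
  "post1 [] = {1..M1}"
| "post1 (a # z) = {w \<in> post1 z. e1 w (rev (map snd z)) = fst a}"

primrec post2 :: "(bool \<times> nat) list \<Rightarrow> nat set" where
  "post2 [] = {1..M2}"
| "post2 (a # z) = {w \<in> post2 z. adder_output (fst a) (e2 w (rev (map snd z))) (snd a)}"

definition sends1 :: "bool \<Rightarrow> (bool \<times> nat) list \<Rightarrow> real" where
  "sends1 x z = card {w \<in> post1 z. e1 w (rev (map snd z)) = x}"

definition sends2 :: "bool \<Rightarrow> (bool \<times> nat) list \<Rightarrow> real" where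
  "sends2 x z = card {w \<in> post2 z. e2 w (rev (map snd z)) = x}"

definition wt :: "(bool \<times> nat) list \<Rightarrow> real" where
  "wt z = card (post1 z) * card (post2 z)"

text \<open>This is \<open>M1 * M2\<close> times an expectation over transcripts: each of the
  \<open>wt z\<close> message pairs leads to \<open>z\<close> with probability
  \<open>1 / 2 ^ n\<close>.\<close>

definition mean :: "nat \<Rightarrow> ((bool \<times> nat) list \<Rightarrow> real) \<Rightarrow> real" where
  "mean n F = (\<Sum>z\<in>transcripts n. wt z * F z) / 2 ^ n"

text \<open>The conditional probability that the next input is 0. For an impossible transcript the
  quotient may be 0/0, that is 0; such transcripts have weight 0.\<close>

definition prob1 :: "(bool \<times> nat) list \<Rightarrow> real" where
  "prob1 z = sends1 False z / card (post1 z)"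

definition prob2 :: "(bool \<times> nat) list \<Rightarrow> real" where
  "prob2 z = sends2 False z / card (post2 z)"

lemma finite_post [simp]: "finite (post1 z)" "finite (post2 z)"
  by (induction z) auto

lemma sends_sum: "sends1 False z + sends1 True z = card (post1 z)" "sends2 False z + sends2 True z = card (post2 z)"
proof -
  have "card {w \<in> A. \<not> P w} + card {w \<in> A. P w} = card A" if "finite A" for A :: "nat set" and P
    using that by (subst card_Un_disjoint[symmetric]) (auto intro!: arg_cong[where f = card])
  from this[of "post1 z" "\<lambda>w. e1 w (rev (map snd z))"] this[of "post2 z" "\<lambda>w. e2 w (rev (map snd z))"]
  show "sends1 False z + sends1 True z = card (post1 z)" "sends2 False z + sends2 True z = card (post2 z)"
    by (simp_all add: sends1_def sends2_def flip: of_nat_add)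
qed

lemma sends_nonneg: "0 \<le> sends1 x z" "0 \<le> sends2 x z"
  by (auto simp: sends1_def sends2_def)

lemma prob_bounds: "prob1 z \<in> {0..1}" "prob2 z \<in> {0..1}"
proof -
  have "u / m \<in> {0..1}" if "u + v = m" "0 \<le> u" "0 \<le> v" for u v m :: real
    using that by (auto simp: divide_le_eq_1)
  then show "prob1 z \<in> {0..1}" "prob2 z \<in> {0..1}"
    unfolding prob1_def prob2_def using sends_sum[of z] sends_nonneg by blast+
qed

section \<open>Effect of one channel use on the candidate sets\<close>

lemma card_post1_Cons: "real (card (post1 ((x, y) # z))) = sends1 x z"
  by (simp add: sends1_def)

text \<open>Everything depends on the output minus the first input: 0 and 2 reveal the second input,
  1 excludes no message, and other values are impossible.\<close>

lemma card_post2_Cons: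
  "real (card (post2 ((False, 0) # z))) = sends2 False z"
  "real (card (post2 ((False, 1) # z))) = card (post2 z)"
  "real (card (post2 ((False, 2) # z))) = sends2 True z"
  "real (card (post2 ((False, 3) # z))) = 0"
  "real (card (post2 ((True, 0) # z))) = 0"
  "real (card (post2 ((True, 1) # z))) = sends2 False z"
  "real (card (post2 ((True, 2) # z))) = card (post2 z)"
  "real (card (post2 ((True, 3) # z))) = sends2 True z"
  by (auto simp: sends2_def intro!: arg_cong[where f = card])

definition step :: "(bool \<times> nat) list \<Rightarrow> ((bool \<times> nat) list \<Rightarrow> real) \<Rightarrow> real" where
  "step z F = (\<Sum>a\<in>UNIV \<times> {0, 1, 2, 3}. wt (a # z) * F (a # z)) / 2"

lemma mean_Suc:
  assumes "\<And>z. step z F = wt z * G z"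
  shows "mean (Suc n) F = mean n G"
proof -
  have "mean (Suc n) F = (\<Sum>z\<in>transcripts n. step z F) / 2 ^ n"
    by (simp add: mean_def sum_words_Suc step_def flip: sum_divide_distrib)
  then show ?thesis by (simp add: assms mean_def)
qed

lemma step_eq:
  fixes F :: "(bool \<times> nat) list \<Rightarrow> real"
  shows "step z F = (sends1 False z * (sends2 False z * F ((False, 0) # z) + card (post2 z) * F ((False, 1) # z) + sends2 True z * F ((False, 2) # z))
    + sends1 True z * (sends2 False z * F ((True, 1) # z) + card (post2 z) * F ((True, 2) # z) + sends2 True z * F ((True, 3) # z))) / 2"
proof -
  have *: "(UNIV :: bool set) \<times> {0, 1, 2, 3 :: nat} = {(False, 0), (False, 1), (False, 2), (False, 3),
    (True, 0), (True, 1), (True, 2), (True, 3)}"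
    by (auto simp: UNIV_bool)
  show ?thesis
    unfolding step_def *
    by (simp add: wt_def card_post1_Cons card_post2_Cons card_post2_Cons(2)[unfolded One_nat_def]
        card_post2_Cons(6)[unfolded One_nat_def] algebra_simps del: post1.simps post2.simps)
qed

text \<open>Conservation of weight: every candidate pair has two possible continuations, each
  counted with factor 1/2.\<close>

lemma step_1: "step z (\<lambda>_. 1) = wt z * 1"
  unfolding step_eq wt_def of_nat_mult sends_sum[symmetric] by (simp add: algebra_simps)

text \<open>The recorded input splits the candidates of the first user into two blocks, and the
  output does not change them further.\<close>

lemma step_log_post1: "step z (\<lambda>z. log 2 (card (post1 z))) = wt z * (log 2 (card (post1 z)) - hbin (prob1 z))"
proof -
  have "step z (\<lambda>z. log 2 (card (post1 z))) = card (post2 z) *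
     (sends1 False z * log 2 (sends1 False z) + sends1 True z * log 2 (sends1 True z))"
    unfolding step_eq card_post1_Cons sends_sum(2)[symmetric] by (simp add: algebra_simps)
  then show ?thesis
    using log_split[OF sends_nonneg(1)[of False z] sends_nonneg(1)[of True z]]
    by (simp add: sends_sum prob1_def wt_def)
qed

text \<open>With probability 1/2 the output splits the candidates of the second user, and otherwise
  it leaves them alone; hence half the entropy.\<close>

lemma step_log_post2: "step z (\<lambda>z. log 2 (card (post2 z))) = wt z * (log 2 (card (post2 z)) - hbin (prob2 z) / 2)"
proof -
  have "step z (\<lambda>z. log 2 (card (post2 z))) = card (post1 z) *
     (card (post2 z) * log 2 (card (post2 z)) + (sends2 False z * log 2 (sends2 False z) + sends2 True z * log 2 (sends2 True z))) / 2"
    unfolding step_eq card_post2_Cons sends_sum(1)[symmetric] by (simp add: algebra_simps)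
  then show ?thesis
    using log_split[OF sends_nonneg(2)[of False z] sends_nonneg(2)[of True z]]
    by (simp add: sends_sum prob2_def wt_def field_simps)
qed

definition output_law :: "real \<Rightarrow> nat \<Rightarrow> real" where
  "output_law f y = (if y = 0 \<or> y = 3 then (1 - f) / 4 else (1 + f) / 4)"

text \<open>The summand 1 is the noise entropy that \<open>cross\<close> leaves out.\<close>

lemma step_log_output:
  assumes "0 < f" "f < 1"
  shows "step z (\<lambda>z. - log 2 (output_law f (snd (hd z)))) = wt z * (1 + cross f (prob1 z) (prob2 z))"
proof (cases "card (post1 z) = 0 \<or> card (post2 z) = 0")
  case True
  then have "(sends1 False z = 0 \<and> sends1 True z = 0) \<or> (sends2 False z = 0 \<and> sends2 True z = 0 \<and> card (post2 z) = 0)"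
    using sends_sum[of z] sends_nonneg(1)[of _ z] sends_nonneg(2)[of _ z] by (auto simp: add_nonneg_eq_0_iff)
  then show ?thesis
    using True unfolding step_eq by (auto simp: wt_def)
next
  case False
  define m k a b where "m = real (card (post1 z))" and "k = real (card (post2 z))" and "a = prob1 z" and "b = prob2 z"
  have eqs: "sends1 False z = m * a" "sends1 True z = m * (1 - a)" "sends2 False z = k * b" "sends2 True z = k * (1 - b)"
  proof -
    show 1: "sends1 False z = m * a" "sends2 False z = k * b"
      using False by (simp_all add: m_def k_def a_def b_def prob1_def prob2_def)
    show "sends1 True z = m * (1 - a)" "sends2 True z = k * (1 - b)"
      using sends_sum[of z] 1 by (simp_all add: m_def k_def right_diff_distrib)
  qed
  have logs: "log 2 ((1 - f) / 4) = log 2 ((1 - f) / 2) - 1" "log 2 ((1 + f) / 4) = log 2 ((1 + f) / 2) - 1"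
    using assms log_divide[of 2 "(1 - f) / 2" 2] log_divide[of 2 "(1 + f) / 2" 2] by auto
  show ?thesis
    unfolding step_eq wt_def of_nat_mult a_def[symmetric] b_def[symmetric] m_def[symmetric] k_def[symmetric] eqs
    by (simp add: output_law_def logs cross_def field_simps)
qed

section \<open>Averages over transcripts, accumulated over time\<close>

lemma mean_0:
  fixes F :: "(bool \<times> nat) list \<Rightarrow> real"
  shows "mean 0 F = M1 * M2 * F []"
  by (simp add: mean_def words_0 wt_def)

lemma mean_diff: "mean n (\<lambda>z. F z - G z) = mean n F - mean n G"
  by (simp add: mean_def right_diff_distrib sum_subtractf diff_divide_distrib)

lemma mean_add: "mean n (\<lambda>z. F z + G z) = mean n F + mean n G"
  by (simp add: mean_def distrib_left sum.distrib add_divide_distrib)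

lemma mean_cmult: "mean n (\<lambda>z. c * F z) = c * mean n F"
  by (simp add: mean_def sum_distrib_left mult_ac)

lemma mean_mono: "(\<And>z. F z \<le> G z) \<Longrightarrow> mean n F \<le> mean n G"
  unfolding mean_def by (intro divide_right_mono sum_mono mult_left_mono) (auto simp: wt_def)

lemma mean_1: "mean n (\<lambda>_. 1) = M1 * M2"
proof (induction n)
  case (Suc n)
  with mean_Suc[OF step_1] show ?case by simp
qed (simp add: mean_0)

lemma mean_const: "mean n (\<lambda>_. c :: real) = c * (M1 * M2)"
  using mean_cmult[of n c "\<lambda>_. 1"] by (simp add: mean_1)

text \<open>The one-step identity telescopes. Up to the factor \<open>M1 * M2\<close>, this is the
  chain rule for the entropy of the first message given the transcript.\<close>

lemma mean_log_post1:
  "mean n (\<lambda>z. log 2 (card (post1 z))) = M1 * M2 * log 2 M1 - (\<Sum>i<n. mean i (\<lambda>z. hbin (prob1 z)))"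
proof (induction n)
  case (Suc n)
  have "mean (Suc n) (\<lambda>z. log 2 (card (post1 z))) = mean n (\<lambda>z. log 2 (card (post1 z)) - hbin (prob1 z))"
    by (rule mean_Suc) (rule step_log_post1)
  with Suc show ?case by (simp add: mean_diff)
qed (simp add: mean_0)

lemma mean_log_post2:
  "mean n (\<lambda>z. log 2 (card (post2 z))) = M1 * M2 * log 2 M2 - (\<Sum>i<n. mean i (\<lambda>z. hbin (prob2 z))) / 2"
proof (induction n)
  case (Suc n)
  have "mean (Suc n) (\<lambda>z. log 2 (card (post2 z))) = mean n (\<lambda>z. log 2 (card (post2 z)) - 1 / 2 * hbin (prob2 z))"
    by (rule mean_Suc) (simp add: step_log_post2)
  with Suc show ?case unfolding mean_diff mean_cmult by (simp add: field_simps)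
qed (simp add: mean_0)

lemma mean_log_output:
  assumes "0 < f" "f < 1"
  shows "mean n (\<lambda>z. - (\<Sum>y\<leftarrow>map snd z. log 2 (output_law f y)))
    = (\<Sum>i<n. mean i (\<lambda>z. cross f (prob1 z) (prob2 z))) + n * (M1 * M2)"
proof (induction n)
  case (Suc n)
  have "mean (Suc n) (\<lambda>z. - (\<Sum>y\<leftarrow>map snd z. log 2 (output_law f y)))
    = mean n (\<lambda>z. (1 + cross f (prob1 z) (prob2 z)) + - (\<Sum>y\<leftarrow>map snd z. log 2 (output_law f y)))"
  proof (rule mean_Suc)
    fix z
    have "step z (\<lambda>z. - (\<Sum>y\<leftarrow>map snd z. log 2 (output_law f y)))
      = step z (\<lambda>z. - log 2 (output_law f (snd (hd z)))) + - (\<Sum>y\<leftarrow>map snd z. log 2 (output_law f y)) * step z (\<lambda>_. 1)"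
      unfolding step_eq by (simp add: field_simps)
    then show "step z (\<lambda>z. - (\<Sum>y\<leftarrow>map snd z. log 2 (output_law f y)))
      = wt z * ((1 + cross f (prob1 z) (prob2 z)) + - (\<Sum>y\<leftarrow>map snd z. log 2 (output_law f y)))"
      unfolding step_1 step_log_output[OF assms] by (simp add: algebra_simps)
  qed
  with Suc show ?case
    unfolding mean_add mean_1 by (simp add: algebra_simps)
qed (simp add: mean_0)

text \<open>A message pair and a consistent output string determine exactly one transcript, since
  the inputs of the first user are functions of its message and the past outputs.\<close>

lemma sum_transcripts:
  fixes G :: "nat \<Rightarrow> nat \<Rightarrow> nat list \<Rightarrow> real"
  shows "(\<Sum>z\<in>transcripts n. \<Sum>w1\<in>post1 z. \<Sum>w2\<in>post2 z. G w1 w2 (map snd z))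
    = (\<Sum>w1\<in>{1..M1}. \<Sum>w2\<in>{1..M2}. \<Sum>ys\<in>words {0, 1, 2, 3} n. of_bool (consistent (e1 w1) (e2 w2) ys) * G w1 w2 ys)"
proof (induction n arbitrary: G)
  case 0
  show ?case by (simp add: words_0)
next
  case (Suc n)
  \<comment> \<open>Summing over the latest output turns \<open>G\<close> into a function of the
    shorter string, to which the induction hypothesis for arbitrary \<open>G\<close>
    applies.\<close>
  define H where "H w1 w2 ys = (\<Sum>y\<in>{0, 1, 2, 3}. of_bool (adder_output (e1 w1 (rev ys)) (e2 w2 (rev ys)) y) * G w1 w2 (y # ys))" for w1 w2 ys
  have step: "(\<Sum>a\<in>UNIV \<times> {0, 1, 2, 3}. \<Sum>w1\<in>post1 (a # z). \<Sum>w2\<in>post2 (a # z). G w1 w2 (map snd (a # z)))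
     = (\<Sum>w1\<in>post1 z. \<Sum>w2\<in>post2 z. H w1 w2 (map snd z))" for z
  proof -
    let ?ys = "map snd z"
    have "(\<Sum>w1\<in>post1 (a # z). \<Sum>w2\<in>post2 (a # z). G w1 w2 (map snd (a # z))) =
      (\<Sum>w1\<in>post1 z. \<Sum>w2\<in>post2 z. of_bool (e1 w1 (rev ?ys) = fst a) *
        (of_bool (adder_output (e1 w1 (rev ?ys)) (e2 w2 (rev ?ys)) (snd a)) * G w1 w2 (snd a # ?ys)))" for a
    proof -
      have filter: "(\<Sum>w\<in>{w \<in> A. P w}. F w) = (\<Sum>w\<in>A. of_bool (P w) * F w)"
        if "finite A" for A :: "nat set" and P and F :: "nat \<Rightarrow> real"
        using that by (simp add: sum.inter_filter of_bool_def if_distrib[of "\<lambda>c. c * _"] cong: if_cong)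
      have "(\<Sum>w1\<in>post1 (a # z). \<Sum>w2\<in>post2 (a # z). G w1 w2 (map snd (a # z))) =
        (\<Sum>w1\<in>post1 z. \<Sum>w2\<in>post2 z. of_bool (e1 w1 (rev ?ys) = fst a) *
          (of_bool (adder_output (fst a) (e2 w2 (rev ?ys)) (snd a)) * G w1 w2 (snd a # ?ys)))"
        unfolding post1.simps post2.simps list.map filter[OF finite_post(1)] filter[OF finite_post(2)] sum_distrib_left ..
      also have "\<dots> = (\<Sum>w1\<in>post1 z. \<Sum>w2\<in>post2 z. of_bool (e1 w1 (rev ?ys) = fst a) *
          (of_bool (adder_output (e1 w1 (rev ?ys)) (e2 w2 (rev ?ys)) (snd a)) * G w1 w2 (snd a # ?ys)))"
        by (intro sum.cong refl) (case_tac "e1 w1 (rev ?ys) = fst a", simp_all)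
      finally show ?thesis .
    qed
    then have "(\<Sum>a\<in>UNIV \<times> {0, 1, 2, 3}. \<Sum>w1\<in>post1 (a # z). \<Sum>w2\<in>post2 (a # z). G w1 w2 (map snd (a # z)))
      = (\<Sum>a\<in>UNIV \<times> {0, 1, 2, 3}. \<Sum>w1\<in>post1 z. \<Sum>w2\<in>post2 z. of_bool (e1 w1 (rev ?ys) = fst a) *
        (of_bool (adder_output (e1 w1 (rev ?ys)) (e2 w2 (rev ?ys)) (snd a)) * G w1 w2 (snd a # ?ys)))"
      by (simp only:)
    also have "\<dots> = (\<Sum>w1\<in>post1 z. \<Sum>w2\<in>post2 z. \<Sum>a\<in>UNIV \<times> {0, 1, 2, 3}. of_bool (e1 w1 (rev ?ys) = fst a) *
        (of_bool (adder_output (e1 w1 (rev ?ys)) (e2 w2 (rev ?ys)) (snd a)) * G w1 w2 (snd a # ?ys)))"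
      by (subst sum.swap, intro sum.cong refl, rule sum.swap)
    also have "\<dots> = (\<Sum>w1\<in>post1 z. \<Sum>w2\<in>post2 z. H w1 w2 ?ys)"
    proof (intro sum.cong refl)
      fix w1 w2
      have "(\<Sum>a\<in>UNIV \<times> {0, 1, 2, 3}. of_bool (e1 w1 (rev ?ys) = fst a) *
        (of_bool (adder_output (e1 w1 (rev ?ys)) (e2 w2 (rev ?ys)) (snd a)) * G w1 w2 (snd a # ?ys)))
        = (\<Sum>x\<in>UNIV. \<Sum>y\<in>{0, 1, 2, 3}. of_bool (e1 w1 (rev ?ys) = x) *
        (of_bool (adder_output (e1 w1 (rev ?ys)) (e2 w2 (rev ?ys)) y) * G w1 w2 (y # ?ys)))"
        unfolding sum.cartesian_product by (simp add: case_prod_beta')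
      also have "\<dots> = (\<Sum>x\<in>UNIV. of_bool (e1 w1 (rev ?ys) = x) * H w1 w2 ?ys)"
        unfolding H_def sum_distrib_left ..
      also have "\<dots> = H w1 w2 ?ys"
        by (cases "e1 w1 (rev ?ys)") (simp_all add: UNIV_bool)
      finally show "(\<Sum>a\<in>UNIV \<times> {0, 1, 2, 3}. of_bool (e1 w1 (rev ?ys) = fst a) *
        (of_bool (adder_output (e1 w1 (rev ?ys)) (e2 w2 (rev ?ys)) (snd a)) * G w1 w2 (snd a # ?ys))) = H w1 w2 ?ys" .
    qed
    finally show ?thesis .
  qed
  have "(\<Sum>z\<in>transcripts (Suc n). \<Sum>w1\<in>post1 z. \<Sum>w2\<in>post2 z. G w1 w2 (map snd z))
    = (\<Sum>z\<in>transcripts n. \<Sum>w1\<in>post1 z. \<Sum>w2\<in>post2 z. H w1 w2 (map snd z))"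
    unfolding sum_words_Suc step ..
  also have "\<dots> = (\<Sum>w1\<in>{1..M1}. \<Sum>w2\<in>{1..M2}. \<Sum>ys\<in>words {0, 1, 2, 3} n. of_bool (consistent (e1 w1) (e2 w2) ys) * H w1 w2 ys)"
    by (rule Suc.IH)
  also have "\<dots> = (\<Sum>w1\<in>{1..M1}. \<Sum>w2\<in>{1..M2}. \<Sum>ys\<in>words {0, 1, 2, 3} (Suc n). of_bool (consistent (e1 w1) (e2 w2) ys) * G w1 w2 ys)"
    unfolding sum_words_Suc H_def sum_distrib_left consistent.simps of_bool_conj mult.assoc ..
  finally show ?case .
qed

section \<open>The pair of messages given the outputs alone, and the converse\<close>

definition pairs :: "nat list \<Rightarrow> nat" where
  "pairs ys = card {(w1, w2) \<in> {1..M1} \<times> {1..M2}. consistent (e1 w1) (e2 w2) ys}"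

lemma pairs_eq: "real (pairs ys) = (\<Sum>w1\<in>{1..M1}. \<Sum>w2\<in>{1..M2}. of_bool (consistent (e1 w1) (e2 w2) ys))"
proof -
  have "real (pairs ys) = (\<Sum>(w1, w2)\<in>{1..M1} \<times> {1..M2}. of_bool (consistent (e1 w1) (e2 w2) ys))"
    by (auto simp: pairs_def case_prod_beta' sum_of_bool_eq intro!: arg_cong[where f = card])
  then show ?thesis unfolding sum.cartesian_product .
qed

lemma pairs_le: "pairs ys \<le> M1 * M2"
proof -
  have "pairs ys \<le> card ({1..M1} \<times> {1..M2})"
    unfolding pairs_def by (intro card_mono) auto
  then show ?thesis by simp
qed

lemma mean_outputs:
  fixes F :: "nat list \<Rightarrow> real"
  shows "mean n (\<lambda>z. F (map snd z)) = (\<Sum>ys\<in>words {0, 1, 2, 3} n. pairs ys * F ys) / 2 ^ n"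
proof -
  have "(\<Sum>z\<in>transcripts n. wt z * F (map snd z)) = (\<Sum>w1\<in>{1..M1}. \<Sum>w2\<in>{1..M2}.
      \<Sum>ys\<in>words {0, 1, 2, 3} n. of_bool (consistent (e1 w1) (e2 w2) ys) * F ys)"
    unfolding sum_transcripts[symmetric, of "\<lambda>_ _. F"] by (simp add: wt_def mult.assoc)
  also have "\<dots> = (\<Sum>w1\<in>{1..M1}. \<Sum>ys\<in>words {0, 1, 2, 3} n.
      \<Sum>w2\<in>{1..M2}. of_bool (consistent (e1 w1) (e2 w2) ys) * F ys)"
    by (intro sum.cong refl) (rule sum.swap)
  also have "\<dots> = (\<Sum>ys\<in>words {0, 1, 2, 3} n. \<Sum>w1\<in>{1..M1}.
      \<Sum>w2\<in>{1..M2}. of_bool (consistent (e1 w1) (e2 w2) ys) * F ys)"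
    by (rule sum.swap)
  also have "\<dots> = (\<Sum>ys\<in>words {0, 1, 2, 3} n. pairs ys * F ys)"
    by (simp add: pairs_eq sum_distrib_right)
  finally show ?thesis by (simp add: mean_def)
qed

text \<open>Up to the factor \<open>M1 * M2\<close>, the left side is the mutual information between
  messages and output string, because given \<open>ys\<close> the pair is uniform on
  \<open>pairs ys\<close> candidates. It equals the output entropy less \<open>n\<close> bits of
  noise. Gibbs' inequality against independent outputs of law \<open>output_law f\<close> then gives
  one \<open>cross\<close> term per instant.\<close>

lemma output_entropy_le:
  assumes M: "M1 \<ge> 1" "M2 \<ge> 1" and f: "0 < f" "f < 1"
  shows "M1 * M2 * log 2 (M1 * M2) - (\<Sum>ys\<in>words {0, 1, 2, 3} n. pairs ys * log 2 (pairs ys)) / 2 ^ n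
    \<le> (\<Sum>i<n. mean i (\<lambda>z. cross f (prob1 z) (prob2 z)))"
proof -
  define m where "m = real (M1 * M2)"
  have m: "m > 0" using M by (simp add: m_def)
  let ?W = "words {0, 1, 2, 3 :: nat} n"
  define p where "p ys = pairs ys / 2 ^ n / m" for ys
  define q where "q ys = prod_list (map (output_law f) ys)" for ys
  have law_pos: "0 < output_law f y" for y using f by (simp add: output_law_def)
  have q_pos: "0 < q ys" for ys by (induction ys) (simp_all add: q_def law_pos)
  have log_q: "log 2 (q ys) = (\<Sum>y\<leftarrow>ys. log 2 (output_law f y))" for ys
  proof (induction ys)
    case (Cons y ys)
    have "log 2 (q (y # ys)) = log 2 (output_law f y) + log 2 (q ys)"
      using law_pos[of y] q_pos[of ys] by (simp add: q_def log_mult)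
    then show ?case by (simp add: Cons)
  qed (simp add: q_def)
  have mean_p: "m * (\<Sum>ys\<in>?W. p ys * F ys) = mean n (\<lambda>z. F (map snd z))" for F
    using m unfolding mean_outputs p_def by (simp add: sum_distrib_left sum_divide_distrib)
  have sum_p: "sum p ?W = 1"
    using mean_p[of "\<lambda>_. 1"] M by (auto simp: mean_1 m_def)
  have "sum q ?W = sum (output_law f) {0, 1, 2, 3} ^ n"
    unfolding q_def by (rule sum_words_prod_list)
  also have "\<dots> = 1" by (simp add: output_law_def field_simps)
  finally have "sum q ?W \<le> sum p ?W" by (simp only: sum_p)
  then have "- (\<Sum>ys\<in>?W. p ys * log 2 (p ys)) \<le> - (\<Sum>ys\<in>?W. p ys * log 2 (q ys))"
    by (intro entropy_le_cross_entropy) (use m in \<open>auto simp: q_pos p_def finite_words\<close>)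
  then have "- (m * (\<Sum>ys\<in>?W. p ys * log 2 (p ys))) \<le> - (m * (\<Sum>ys\<in>?W. p ys * log 2 (q ys)))"
    using m by simp
  also have "\<dots> = mean n (\<lambda>z. - (\<Sum>y\<leftarrow>map snd z. log 2 (output_law f y)))"
    unfolding log_q mean_p using mean_cmult[of n "-1"] by simp
  also have "\<dots> = (\<Sum>i<n. mean i (\<lambda>z. cross f (prob1 z) (prob2 z))) + n * m"
    unfolding mean_log_output[OF f] m_def by simp
  \<comment> \<open>Since \<open>p ys\<close> is \<open>pairs ys\<close> divided by
    \<open>2 ^ n * m\<close>, the logarithms differ by a constant; strings without candidates
    contribute 0 to both sides.\<close>
  also have "(\<Sum>ys\<in>?W. p ys * log 2 (p ys)) = (\<Sum>ys\<in>?W. p ys * log 2 (pairs ys)) - (n + log 2 m) * sum p ?W"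
  proof -
    have "p ys * log 2 (p ys) = p ys * log 2 (pairs ys) - (n + log 2 m) * p ys" for ys
    proof (cases "pairs ys = 0")
      case False
      have "log 2 (2 ^ n * m) = n + log 2 m" using m by (simp add: log_mult log_nat_power)
      then have "log 2 (p ys) = log 2 (pairs ys) - (n + log 2 m)"
        using m False by (simp add: p_def log_divide)
      then show ?thesis by (simp only: right_diff_distrib mult.commute)
    qed (simp add: p_def)
    then show ?thesis by (simp add: sum_subtractf sum_distrib_left)
  qed
  also have "m * (\<dots>) = (\<Sum>ys\<in>?W. pairs ys * log 2 (pairs ys)) / 2 ^ n - m * (n + log 2 m)"
    using m unfolding sum_p right_diff_distrib p_def by (simp add: sum_distrib_left sum_divide_distrib)
  finally show ?thesis by (simp add: m_def algebra_simps)
qed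

text \<open>Here \<open>m\<close> is a weight, \<open>s\<close> its correctly decoded part and
  \<open>k\<close> a number of candidates. With two or more candidates at least half of the weight
  is lost, so \<open>m\<close> is at most \<open>2 * (m - s)\<close>; with fewer, the logarithm is
  0.\<close>

lemma mult_log_le:
  fixes m s :: real and k M :: nat
  assumes "0 \<le> s" "s \<le> m" "2 \<le> k \<Longrightarrow> 2 * s \<le> m" "k \<le> M"
  shows "m * log 2 k \<le> 2 * log 2 M * (m - s)"
proof (cases "2 \<le> k")
  case True
  have "m * log 2 k \<le> m * log 2 M"
    using True assms by (intro mult_left_mono) auto
  also have "\<dots> \<le> (2 * (m - s)) * log 2 M"
    using True assms by (intro mult_right_mono) auto
  finally show ?thesis by (simp add: algebra_simps)
next
  case False
  then consider "k = 0" | "k = 1" by linarith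
  then have "log 2 k = 0" by cases (auto simp: log_def)
  moreover have "0 \<le> log 2 M" by (cases "M = 0") (auto simp: log_def)
  ultimately show ?thesis using assms by simp
qed

lemma card_post_le: "card (post1 z) \<le> M1" "card (post2 z) \<le> M2"
proof -
  have "post1 z \<subseteq> {1..M1}" "post2 z \<subseteq> {1..M2}" by (induction z) auto
  then show "card (post1 z) \<le> M1" "card (post2 z) \<le> M2"
    using card_mono[of "{1..M1}"] card_mono[of "{1..M2}"] by fastforce+
qed

text \<open>Instead of Fano's inequality: a posteriori, the messages are uniform, so that a decoder
  errs with probability at least 1/2 whenever there are two or more candidates.\<close>

lemma converse:
  fixes err :: real and d :: "nat list \<Rightarrow> nat \<times> nat"
  assumes M: "M1 \<ge> 1" "M2 \<ge> 1" and f: "0 < f" "f < 1"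
    and err: "M1 * M2 * (1 - err) = (\<Sum>w1\<in>{1..M1}. \<Sum>w2\<in>{1..M2}. \<Sum>ys\<in>words {0, 1, 2, 3} n.
      of_bool (d ys = (w1, w2)) * of_bool (consistent (e1 w1) (e2 w2) ys)) / 2 ^ n"
  shows "(1 - 2 * err) * (M1 * M2 * log 2 M1) \<le> (\<Sum>i<n. mean i (\<lambda>z. hbin (prob1 z)))" (is ?C1)
    and "(1 - 2 * err) * (M1 * M2 * log 2 M2) \<le> (\<Sum>i<n. mean i (\<lambda>z. hbin (prob2 z))) / 2" (is ?C2)
    and "(1 - 2 * err) * (M1 * M2 * log 2 (M1 * M2)) \<le> (\<Sum>i<n. mean i (\<lambda>z. cross f (prob1 z) (prob2 z)))" (is ?C3)
proof -
  let ?W = "words {0, 1, 2, 3 :: nat} n"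
  \<comment> \<open>The number, 0 or 1, of candidate pairs of \<open>z\<close> that are decoded
    correctly; \<open>t\<close> is its analogue for output strings.\<close>
  define s where "s z = (\<Sum>w1\<in>post1 z. \<Sum>w2\<in>post2 z. of_bool (d (map snd z) = (w1, w2)) :: real)" for z
  define t where "t ys = (\<Sum>w1\<in>{1..M1}. \<Sum>w2\<in>{1..M2}. of_bool (d ys = (w1, w2)) * of_bool (consistent (e1 w1) (e2 w2) ys) :: real)" for ys
  have sum_s: "(\<Sum>z\<in>transcripts n. s z) = M1 * M2 * (1 - err) * 2 ^ n"
    unfolding s_def sum_transcripts[of "\<lambda>w1 w2 ys. of_bool (d ys = (w1, w2))"] err by (simp add: mult.commute)
  have "(\<Sum>w1\<in>{1..M1}. \<Sum>w2\<in>{1..M2}. \<Sum>ys\<in>?W. of_bool (d ys = (w1, w2)) * of_bool (consistent (e1 w1) (e2 w2) ys) :: real)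
     = (\<Sum>w1\<in>{1..M1}. \<Sum>ys\<in>?W. \<Sum>w2\<in>{1..M2}. of_bool (d ys = (w1, w2)) * of_bool (consistent (e1 w1) (e2 w2) ys))"
    by (intro sum.cong refl) (rule sum.swap)
  also have "\<dots> = (\<Sum>ys\<in>?W. t ys)"
    unfolding t_def by (rule sum.swap)
  finally have sum_t: "(\<Sum>ys\<in>?W. t ys) = M1 * M2 * (1 - err) * 2 ^ n"
    unfolding err by simp
  have unique: "(\<Sum>w1\<in>A. \<Sum>w2\<in>B. of_bool (p = (w1, w2)) * g w1 w2 :: real) = of_bool (p \<in> A \<times> B) * g (fst p) (snd p)"
    if "finite A" "finite B" for A B :: "nat set" and p g
  proof -
    have "(\<Sum>w1\<in>A. \<Sum>w2\<in>B. of_bool (p = (w1, w2)) * g w1 w2) = (\<Sum>x\<in>A \<times> B. if p = x then g (fst x) (snd x) else 0)"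
      unfolding sum.cartesian_product by (intro sum.cong refl) auto
    also have "\<dots> = of_bool (p \<in> A \<times> B) * g (fst p) (snd p)"
      using that by (subst sum.delta') auto
    finally show ?thesis .
  qed
  have s_eq: "s z = of_bool (d (map snd z) \<in> post1 z \<times> post2 z)" for z
    using unique[of "post1 z" "post2 z" "d (map snd z)" "\<lambda>_ _. 1"] by (simp add: s_def)
  have sum_wt: "(\<Sum>z\<in>transcripts n. wt z) = M1 * M2 * 2 ^ n"
    using mean_1[of n] by (simp add: mean_def field_simps)
  have pos: "1 \<le> card (post1 z) \<and> 1 \<le> card (post2 z)" if "d (map snd z) \<in> post1 z \<times> post2 z" for z
    using that by (auto simp: Suc_le_eq card_gt_0_iff)
  have s_le: "s z \<le> wt z" "2 \<le> card (post1 z) \<Longrightarrow> 2 * s z \<le> wt z" "2 \<le> card (post2 z) \<Longrightarrow> 2 * s z \<le> wt z" for z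
  proof -
    define k where "k = card (post1 z) * card (post2 z)"
    have wt: "wt z = real k" by (simp add: wt_def k_def)
    show "s z \<le> wt z" "2 \<le> card (post1 z) \<Longrightarrow> 2 * s z \<le> wt z" "2 \<le> card (post2 z) \<Longrightarrow> 2 * s z \<le> wt z"
    proof (atomize (full), cases "d (map snd z) \<in> post1 z \<times> post2 z")
      case True
      with pos[of z] have "1 \<le> k" "2 \<le> card (post1 z) \<Longrightarrow> 2 \<le> k" "2 \<le> card (post2 z) \<Longrightarrow> 2 \<le> k"
        unfolding k_def using mult_le_mono[of 1 "card (post1 z)" 1 "card (post2 z)"]
          mult_le_mono[of 2 "card (post1 z)" 1 "card (post2 z)"] mult_le_mono[of 1 "card (post1 z)" 2 "card (post2 z)"]
        by linarith+
      moreover have "s z = 1" using True by (simp add: s_eq)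
      ultimately show "s z \<le> wt z \<and> (2 \<le> card (post1 z) \<longrightarrow> 2 * s z \<le> wt z) \<and> (2 \<le> card (post2 z) \<longrightarrow> 2 * s z \<le> wt z)"
        unfolding wt by simp
    next
      case False
      then have "s z = 0" by (simp add: s_eq)
      then show "s z \<le> wt z \<and> (2 \<le> card (post1 z) \<longrightarrow> 2 * s z \<le> wt z) \<and> (2 \<le> card (post2 z) \<longrightarrow> 2 * s z \<le> wt z)"
        unfolding wt by simp
    qed
  qed
  \<comment> \<open>The lost weights \<open>wt z - s z\<close> add up to the error probability. The
    factor 2 from \<open>mult_log_le\<close> becomes the factor \<open>1 - 2 * err\<close> in the
    claims.\<close>
  have bound: "mean n (\<lambda>z. log 2 (k z)) \<le> 2 * log 2 N * (M1 * M2 * err)"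
    if "\<And>z. 2 \<le> k z \<Longrightarrow> 2 * s z \<le> wt z" "\<And>z. k z \<le> N" for k :: "_ \<Rightarrow> nat" and N :: nat
  proof -
    have "mean n (\<lambda>z. log 2 (k z)) \<le> (\<Sum>z\<in>transcripts n. 2 * log 2 N * (wt z - s z)) / 2 ^ n"
      unfolding mean_def using that s_le(1)
      by (intro divide_right_mono sum_mono mult_log_le) (auto simp: s_eq)
    also have "\<dots> = 2 * log 2 N * (M1 * M2 * err)"
      unfolding sum_distrib_left[symmetric] sum_subtractf sum_s sum_wt by (simp add: field_simps)
    finally show ?thesis .
  qed
  show ?C1
    using bound[of "\<lambda>z. card (post1 z)" M1] s_le card_post_le unfolding mean_log_post1 by (simp add: algebra_simps)
  show ?C2
    using bound[of "\<lambda>z. card (post2 z)" M2] s_le card_post_le unfolding mean_log_post2 by (simp add: algebra_simps)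
  have t_eq: "t ys = of_bool (d ys \<in> {(w1, w2) \<in> {1..M1} \<times> {1..M2}. consistent (e1 w1) (e2 w2) ys})" for ys
    unfolding t_def by (subst unique) auto
  have t_le: "t ys \<le> pairs ys" "2 \<le> pairs ys \<Longrightarrow> 2 * t ys \<le> pairs ys" for ys
  proof -
    have "1 \<le> pairs ys" if "d ys \<in> {(w1, w2) \<in> {1..M1} \<times> {1..M2}. consistent (e1 w1) (e2 w2) ys}"
    proof -
      have "finite {(w1, w2) \<in> {1..M1} \<times> {1..M2}. consistent (e1 w1) (e2 w2) ys}"
        by (rule finite_subset[of _ "{1..M1} \<times> {1..M2}"]) auto
      with that have "0 < pairs ys" unfolding pairs_def card_gt_0_iff by blast
      then show ?thesis by simp
    qed
    then show "t ys \<le> pairs ys" "2 \<le> pairs ys \<Longrightarrow> 2 * t ys \<le> pairs ys"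
      unfolding t_eq by auto
  qed
  have "(\<Sum>ys\<in>?W. pairs ys * log 2 (pairs ys)) \<le> (\<Sum>ys\<in>?W. 2 * log 2 (M1 * M2) * (pairs ys - t ys))"
    using t_le pairs_le by (intro sum_mono mult_log_le) (auto simp: t_eq simp del: of_nat_mult)
  also have "\<dots> = 2 * log 2 (M1 * M2) * (M1 * M2 * err) * 2 ^ n"
  proof -
    have "(\<Sum>ys\<in>?W. real (pairs ys)) = M1 * M2 * 2 ^ n"
      using mean_outputs[of n "\<lambda>_. 1"] mean_1[of n] by (simp add: field_simps)
    then show ?thesis
      unfolding sum_distrib_left[symmetric] sum_subtractf sum_t by (simp add: field_simps)
  qed
  finally have "(\<Sum>ys\<in>?W. pairs ys * log 2 (pairs ys)) / 2 ^ n \<le> 2 * log 2 (M1 * M2) * (M1 * M2 * err)"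
    by (simp add: divide_le_eq)
  with output_entropy_le[OF M f, of n] show ?C3
    by (simp add: algebra_simps)
qed

text \<open>The three converse bounds are added with weights \<open>c1\<close>,
  \<open>2 * c2\<close> and 1. The pointwise inequality then holds at every instant and every
  transcript, so it survives averaging and summation.\<close>

lemma converse_lagrange:
  fixes err R c1 c2 :: real and d :: "nat list \<Rightarrow> nat \<times> nat"
  assumes M: "M1 \<ge> 1" "M2 \<ge> 1" and f: "0 < f" "f < 1"
    and err: "M1 * M2 * (1 - err) = (\<Sum>w1\<in>{1..M1}. \<Sum>w2\<in>{1..M2}. \<Sum>ys\<in>words {0, 1, 2, 3} n.
      of_bool (d ys = (w1, w2)) * of_bool (consistent (e1 w1) (e2 w2) ys)) / 2 ^ n"
    and c: "0 \<le> c1" "0 \<le> c2"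
    and lagr: "\<And>a b. a \<in> {0..1} \<Longrightarrow> b \<in> {0..1} \<Longrightarrow> cross f a b + c1 * (hbin a - R) + c2 * (hbin b - 2 * R) \<le> 2 * R"
  shows "(1 - 2 * err) * ((1 + c1) * log 2 M1 + (1 + 2 * c2) * log 2 M2) \<le> n * (R * (2 + c1 + 2 * c2))"
proof -
  note conv = converse[OF M f err]
  define m where "m = real (M1 * M2)"
  have m: "m > 0" using M by (simp add: m_def)
  define A B C where "A = (\<Sum>i<n. mean i (\<lambda>z. hbin (prob1 z)))" and "B = (\<Sum>i<n. mean i (\<lambda>z. hbin (prob2 z)))"
    and "C = (\<Sum>i<n. mean i (\<lambda>z. cross f (prob1 z) (prob2 z)))"
  have "mean i (\<lambda>z. cross f (prob1 z) (prob2 z)) + (c1 * mean i (\<lambda>z. hbin (prob1 z)) + c2 * mean i (\<lambda>z. hbin (prob2 z)))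
     \<le> m * (R * (2 + c1 + 2 * c2))" for i
  proof -
    have "mean i (\<lambda>z. cross f (prob1 z) (prob2 z) + (c1 * hbin (prob1 z) + c2 * hbin (prob2 z)))
       \<le> mean i (\<lambda>_. R * (2 + c1 + 2 * c2))"
    proof (rule mean_mono)
      fix z show "cross f (prob1 z) (prob2 z) + (c1 * hbin (prob1 z) + c2 * hbin (prob2 z)) \<le> R * (2 + c1 + 2 * c2)"
        using lagr[OF prob_bounds, of z z] by (simp add: algebra_simps)
    qed
    then show ?thesis unfolding mean_add mean_cmult mean_const by (simp add: m_def algebra_simps)
  qed
  then have "(\<Sum>i<n. mean i (\<lambda>z. cross f (prob1 z) (prob2 z)) + (c1 * mean i (\<lambda>z. hbin (prob1 z)) + c2 * mean i (\<lambda>z. hbin (prob2 z))))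
     \<le> (\<Sum>i<n. m * (R * (2 + c1 + 2 * c2)))"
    by (intro sum_mono)
  then have "C + c1 * A + c2 * B \<le> n * (m * (R * (2 + c1 + 2 * c2)))"
    by (simp add: A_def B_def C_def sum.distrib sum_distrib_left)
  moreover have "c1 * ((1 - 2 * err) * (m * log 2 M1)) \<le> c1 * A"
    using conv(1) c by (intro mult_left_mono) (simp_all add: A_def m_def)
  moreover have "c2 * (2 * ((1 - 2 * err) * (m * log 2 M2))) \<le> c2 * B"
    using conv(2) c by (intro mult_left_mono) (simp_all add: B_def m_def)
  moreover have "(1 - 2 * err) * (m * (log 2 M1 + log 2 M2)) \<le> C"
    using conv(3) M by (simp add: C_def m_def log_mult)
  ultimately have "m * ((1 - 2 * err) * ((1 + c1) * log 2 M1 + (1 + 2 * c2) * log 2 M2)) \<le> m * (n * (R * (2 + c1 + 2 * c2)))"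
    by (simp add: algebra_simps)
  then show ?thesis using m by simp
qed

end

section \<open>The optimal symmetric rate\<close>

lemma achievable_le:
  assumes ach: "achievable noisy_adder (R1, R2)" and f: "0 < f" "f < 1" and R: "0 \<le> R"
    and c: "0 \<le> c1" "0 \<le> c2"
    and lagr: "\<And>a b. a \<in> {0..1} \<Longrightarrow> b \<in> {0..1} \<Longrightarrow> cross f a b + c1 * (hbin a - R) + c2 * (hbin b - 2 * R) \<le> 2 * R"
  shows "(1 + c1) * R1 + (1 + 2 * c2) * R2 \<le> R * (2 + c1 + 2 * c2)"
proof (rule ccontr)
  define x y where "x = (1 + c1) * R1 + (1 + 2 * c2) * R2" and "y = R * (2 + c1 + 2 * c2)"
  assume "\<not> ?thesis"
  then have xy: "y < x" by (simp add: x_def y_def)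
  have "0 \<le> y" using R c by (simp add: y_def)
  \<comment> \<open>With this choice \<open>(1 - 2 * \<epsilon>) * x\<close> is the midpoint of
    \<open>x\<close> and \<open>y\<close>, which still exceeds \<open>y\<close>.\<close>
  define \<epsilon> where "\<epsilon> = (x - y) / (4 * x)"
  have \<epsilon>: "0 < \<epsilon>" "\<epsilon> \<le> 1/4" using xy \<open>0 \<le> y\<close> by (auto simp: \<epsilon>_def field_simps)
  have R12: "0 \<le> R1" "0 \<le> R2" using ach by (auto simp: achievable_def)
  from ach \<epsilon>(1) have "\<forall>\<^sub>F n in sequentially. \<exists>C. fb_code_wf n C \<and> R1 \<le> log 2 (msgs1 C) / n \<and>
     R2 \<le> log 2 (msgs2 C) / n \<and> error_prob noisy_adder n C \<le> \<epsilon>"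
    by (simp add: achievable_def)
  then obtain N where N: "\<And>n. n \<ge> N \<Longrightarrow> \<exists>C. fb_code_wf n C \<and> R1 \<le> log 2 (msgs1 C) / n \<and>
     R2 \<le> log 2 (msgs2 C) / n \<and> error_prob noisy_adder n C \<le> \<epsilon>"
    unfolding eventually_sequentially by blast
  \<comment> \<open>The successor keeps the block length positive, as the rates are quotients by
    \<open>n\<close>.\<close>
  define n where "n = Suc N"
  have n: "real n > 0" by (simp add: n_def)
  from N[of n] obtain C :: "(bool, bool, nat) fb_code" where C: "fb_code_wf n C" "R1 \<le> log 2 (msgs1 C) / n"
     "R2 \<le> log 2 (msgs2 C) / n" "error_prob noisy_adder n C \<le> \<epsilon>"
    by (auto simp: n_def)
  have M: "msgs1 C \<ge> 1" "msgs2 C \<ge> 1" using C(1) by (auto simp: fb_code_wf_def)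
  have "(1 - 2 * error_prob noisy_adder n C) * ((1 + c1) * log 2 (msgs1 C) + (1 + 2 * c2) * log 2 (msgs2 C)) \<le> n * y"
    unfolding y_def using error_prob_eq[OF M, of n]
    by (intro converse_lagrange[where d = "\<lambda>ys. dec C (rev ys)", OF M f _ c lagr]) auto
  moreover have "(1 - 2 * \<epsilon>) * (n * x) \<le>
      (1 - 2 * error_prob noisy_adder n C) * ((1 + c1) * log 2 (msgs1 C) + (1 + 2 * c2) * log 2 (msgs2 C))"
  proof (rule mult_mono)
    have "n * R1 \<le> log 2 (msgs1 C)" "n * R2 \<le> log 2 (msgs2 C)"
      using C(2,3) n by (simp_all add: field_simps)
    then have "(1 + c1) * (n * R1) + (1 + 2 * c2) * (n * R2) \<le> (1 + c1) * log 2 (msgs1 C) + (1 + 2 * c2) * log 2 (msgs2 C)"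
      using c by (intro add_mono mult_left_mono) auto
    then show "n * x \<le> (1 + c1) * log 2 (msgs1 C) + (1 + 2 * c2) * log 2 (msgs2 C)"
      by (simp add: x_def algebra_simps)
    show "0 \<le> n * x" using xy \<open>0 \<le> y\<close> by simp
  qed (use C(4) \<epsilon> in auto)
  ultimately have "n * ((1 - 2 * \<epsilon>) * x) \<le> n * y" by (simp add: mult_ac)
  then have "(1 - 2 * \<epsilon>) * x \<le> y" using n by simp
  moreover have "(1 - 2 * \<epsilon>) * x = (x + y) / 2"
    using xy \<open>0 \<le> y\<close> by (simp add: \<epsilon>_def field_simps)
  ultimately show False using xy by simp
qed

text \<open>The weighted bound describes a closed half-plane, which therefore contains the closure
  too. On the diagonal its two weights add up to the coefficient \<open>2 + c1 + 2 * c2\<close> of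
  \<open>R\<close>.\<close>

lemma capacity_region_le:
  assumes "(R', R') \<in> capacity_region noisy_adder" and f: "0 < f" "f < 1" and R: "0 \<le> R"
    and c: "0 \<le> c1" "0 \<le> c2"
    and lagr: "\<And>a b. a \<in> {0..1} \<Longrightarrow> b \<in> {0..1} \<Longrightarrow> cross f a b + c1 * (hbin a - R) + c2 * (hbin b - 2 * R) \<le> 2 * R"
  shows "R' \<le> R"
proof -
  let ?H = "{x. (1 + c1) * fst x + (1 + 2 * c2) * snd x \<le> R * (2 + c1 + 2 * c2)}"
  have "closed ?H" by (intro closed_Collect_le continuous_intros)
  moreover have "{R. achievable noisy_adder R} \<subseteq> ?H"
    using achievable_le[OF _ f R c lagr] by force
  ultimately have "capacity_region noisy_adder \<subseteq> ?H"
    unfolding capacity_region_def by (intro closure_minimal)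
  with assms(1) have "(2 + c1 + 2 * c2) * R' \<le> (2 + c1 + 2 * c2) * R"
    by (auto simp: algebra_simps)
  then show ?thesis using c by (simp add: mult_le_cancel_left_pos)
qed

text \<open>Weak duality: if \<open>m\<close> exceeded \<open>R\<close>, both multiplier terms would
  be nonnegative, although \<open>x\<close> is already larger than \<open>2 * R\<close>.\<close>

lemma lagrange_le:
  fixes R m x y z c1 c2 :: real
  assumes "0 \<le> c1" "0 \<le> c2" "x + c1 * (y - R) + c2 * (z - 2 * R) \<le> 2 * R" "m \<le> y" "2 * m \<le> z" "2 * m \<le> x"
  shows "m \<le> R"
proof (rule ccontr)
  assume m: "\<not> m \<le> R"
  have "0 \<le> c1 * (y - R)" "0 \<le> c2 * (z - 2 * R)" using assms m by auto
  then show False using assms m by linarith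
qed

section \<open>The parametrisation by \<open>phi\<close> and the symmetric binary time-sharing
  law\<close>

lemma phi_param:
  assumes "s \<in> {0..1/2}" shows "phi (2 * (s * (1 - s))) = s"
proof -
  have "1 - 2 * (2 * (s * (1 - s))) = (1 - 2 * s)^2" by (simp add: power2_eq_square algebra_simps)
  moreover have "2 * (s * (1 - s)) \<le> 1 / 2"
    using zero_le_power2[of "1 - 2 * s"] by (simp add: power2_eq_square algebra_simps)
  ultimately show ?thesis using assms by (simp add: phi_def)
qed

text \<open>With \<open>phi_param\<close>, this makes \<open>s = phi (2 * u)\<close> and
  \<open>u = s * (1 - s)\<close> inverse changes of variable, so that statements about
  \<open>u1\<close>, \<open>u2\<close> can be proved for \<open>s1\<close>, \<open>s2\<close> and
  carried back.\<close>

lemma phi_bounds: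
  assumes "v \<in> {0..1/4}"
  shows "phi (2 * v) \<in> {0..1/2}" "phi (2 * v) * (1 - phi (2 * v)) = v"
proof -
  have phi: "phi (2 * v) = (1 - sqrt (1 - 4 * v)) / 2" using assms by (simp add: phi_def)
  have "sqrt (1 - 4 * v) \<le> 1" using assms by simp
  then show "phi (2 * v) \<in> {0..1/2}" using assms by (simp add: phi)
  have "sqrt (1 - 4 * v) * sqrt (1 - 4 * v) = 1 - 4 * v" using assms by simp
  then show "phi (2 * v) * (1 - phi (2 * v)) = v" unfolding phi by (simp add: field_simps)
qed

lemma mult_one_minus_mono:
  fixes s t :: real
  assumes "s \<le> t" "t \<le> 1/2" shows "s * (1 - s) \<le> t * (1 - t)"
proof -
  have "0 \<le> (t - s) * (1 - s - t)" using assms by (intro mult_nonneg_nonneg) auto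
  then show ?thesis by (simp add: algebra_simps)
qed

text \<open>\<open>bernoulli_pmf\<close> takes the probability of \<open>True\<close>, the input 1,
  whereas \<open>s\<close> is the probability of the input 0 when \<open>t = 0\<close>.\<close>

definition flip_law :: "real \<Rightarrow> nat \<Rightarrow> bool pmf" where
  "flip_law s t = bernoulli_pmf (if t = 0 then 1 - s else s)"

lemma pmf_flip_law:
  assumes "s \<in> {0..1}"
  shows "pmf (flip_law s 0) False = s" "pmf (flip_law s 1) False = 1 - s"
    "pmf (flip_law s 0) True = 1 - s" "pmf (flip_law s 1) True = s"
  using assms by (simp_all add: flip_law_def)

lemma input_law_flip:
  assumes s: "s1 \<in> {0..1}" "s2 \<in> {0..1}" and f: "f = s1 + s2 - 2 * s1 * s2"
  defines "P \<equiv> input_law (pmf_of_set {0, 1}) (flip_law s1) (flip_law s2)"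
  shows "pmf P (False, False) = (1 - f) / 2" "pmf P (False, True) = f / 2"
     "pmf P (True, False) = f / 2" "pmf P (True, True) = (1 - f) / 2"
  unfolding P_def
  by (simp_all add: pmf_input_law pmf_flip_law[OF s(1), unfolded One_nat_def] pmf_flip_law[OF s(2), unfolded One_nat_def]
      f field_simps)

text \<open>Flipping both inputs with \<open>T\<close> leaves the conditional entropies and the
  probability \<open>f\<close> of unequal inputs unchanged, and makes the output law symmetric. Two
  entropy constraints and the sum-rate constraint then hold with equality.\<close>

lemma rate_constraints_flip:
  assumes s: "0 < s1" "s1 < 1/2" "0 < s2" "s2 < 1/2"
    and f: "f = s1 + s2 - 2 * s1 * s2" and f': "1/3 \<le> f"
    and eq: "2 * hbin s1 = hbin ((1 - f) / 2)" "2 * hbin s1 = hbin s2"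
  shows "rate_constraints noisy_adder (pmf_of_set {0, 1 :: nat}) (flip_law s1) (flip_law s2) (hbin s1)"
proof -
  have fb: "f \<le> 1/2" unfolding f by (rule conv_bounds) (use s in auto)
  have s01: "s1 \<in> {0..1}" "s2 \<in> {0..1}" using s by auto
  note P = input_law_flip[OF s01 f]
  have "(1 - f) / 2 + f / 2 + f / 2 = (1 + f) / 2" "f / 2 + f / 2 + (1 - f) / 2 = (1 + f) / 2"
    "(1 - f) / 2 / 2 = (1 - f) / 4" "(1 + f) / 2 / 2 = (1 + f) / 4" by (auto simp: field_simps)
  moreover have "log 2 ((1 - f) / 4) = log 2 ((1 - f) / 2) - 1" "log 2 ((1 + f) / 4) = log 2 ((1 + f) / 2) - 1"
    using f' fb log_divide[of 2 "(1 - f) / 2" 2] log_divide[of 2 "(1 + f) / 2" 2] by auto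
  moreover have "1 - (1 - f) / 2 = (1 + f) / 2" by (simp add: field_simps)
  ultimately have mi: "mut_inf (io_law (input_law (pmf_of_set {0, 1}) (flip_law s1) (flip_law s2)))
      (\<lambda>(x1, x2, y). (x1, x2)) (\<lambda>(x1, x2, y). y) = hbin ((1 - f) / 2)"
    unfolding mut_inf_inputs_output P hbin_def by (simp only:) (simp add: field_simps)
  \<comment> \<open>The constraint from \<open>I(X1;Y|X2)\<close> reads
    \<open>hbin s1 \<le> hbin f / 2\<close>. For \<open>f\<close> between 1/3 and 1/2,
    \<open>(1 - f) / 2\<close> is at most \<open>f\<close>, so it follows from the sum-rate
    equation.\<close>
  have "hbin ((1 - f) / 2) \<le> hbin f" using f' fb by (subst hbin_le_iff) auto
  then have "hbin s1 \<le> hbin f / 2" using eq by simp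
  moreover have "cond_mut_inf (joint_law noisy_adder (pmf_of_set {0, 1 :: nat}) (flip_law s1) (flip_law s2))
      (\<lambda>(t, x1, x2, y). x1) (\<lambda>(t, x1, x2, y). y) (\<lambda>(t, x1, x2, y). x2) = hbin f / 2"
    unfolding cond_mut_inf_joint_law by (rule cond_mut_inf_symmetric[OF _ _ P]) (use f' fb in auto)
  moreover have "cond_ent (joint_law noisy_adder (pmf_of_set {0, 1 :: nat}) (flip_law s1) (flip_law s2))
      (\<lambda>(t, x1, x2, y). x1) (\<lambda>(t, x1, x2, y). t) = hbin s1"
    by (simp add: cond_ent_X1_T pmf_flip_law[OF s01(1), unfolded One_nat_def] hbin_sym)
  moreover have "cond_ent (joint_law noisy_adder (pmf_of_set {0, 1 :: nat}) (flip_law s1) (flip_law s2))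
      (\<lambda>(t, x1, x2, y). x2) (\<lambda>(t, x1, x2, y). t) = hbin s2"
    by (simp add: cond_ent_X2_T pmf_flip_law[OF s01(2), unfolded One_nat_def] hbin_sym)
  ultimately show ?thesis
    using eq unfolding rate_constraints_def Let_def mut_inf_joint_law by (simp only: mi) simp
qed

text \<open>The pointwise inequality is applied to the input laws given each value of
  \<open>T\<close>, averaged, and followed by weak duality.\<close>

lemma rate_constraints_le:
  assumes "rate_constraints noisy_adder (pT :: nat pmf) q1 q2 R'" and fin: "finite (set_pmf pT)"
    and f: "0 < f" "f < 1" and c: "0 \<le> c1" "0 \<le> c2"
    and lagr: "\<And>a b. a \<in> {0..1} \<Longrightarrow> b \<in> {0..1} \<Longrightarrow> cross f a b + c1 * (hbin a - R) + c2 * (hbin b - 2 * R) \<le> 2 * R"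
  shows "R' \<le> R"
proof (rule lagrange_le[OF c])
  let ?E = "\<lambda>F. \<Sum>t\<in>set_pmf pT. pmf pT t * F (pmf (q1 t) False) (pmf (q2 t) False)"
  have one: "(\<Sum>t\<in>set_pmf pT. pmf pT t) = 1" using fin by (simp add: sum_pmf_eq_1)
  have "?E (\<lambda>a b. cross f a b + c1 * (hbin a - R) + c2 * (hbin b - 2 * R)) \<le> (\<Sum>t\<in>set_pmf pT. pmf pT t * (2 * R))"
    by (intro sum_mono mult_left_mono lagr) (auto simp: pmf_le_1)
  also have "\<dots> = 2 * R" unfolding sum_distrib_right[symmetric] one by simp
  also have "?E (\<lambda>a b. cross f a b + c1 * (hbin a - R) + c2 * (hbin b - 2 * R)) =
     ?E (cross f) + c1 * (?E (\<lambda>a b. hbin a) - (\<Sum>t\<in>set_pmf pT. pmf pT t) * R) + c2 * (?E (\<lambda>a b. hbin b) - (\<Sum>t\<in>set_pmf pT. pmf pT t) * (2 * R))"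
    unfolding sum_distrib_left sum_distrib_right sum_subtractf[symmetric] sum.distrib[symmetric]
    by (intro sum.cong refl) (simp add: algebra_simps)
  finally show "?E (cross f) + c1 * (?E (\<lambda>a b. hbin a) - R) + c2 * (?E (\<lambda>a b. hbin b) - 2 * R) \<le> 2 * R"
    unfolding one by simp
  note constraints = assms(1)[unfolded rate_constraints_def Let_def mut_inf_joint_law
      cond_ent_X1_T[OF fin] cond_ent_X2_T[OF fin]]
  then show "R' \<le> ?E (\<lambda>a b. hbin a)" "2 * R' \<le> ?E (\<lambda>a b. hbin b)" by linarith+
  show "2 * R' \<le> ?E (cross f)"
    using constraints mut_inf_le_cross[OF f fin, of q1 q2] by linarith
qed

theorem mainTheorem3:
  shows "\<exists>u1 u2 Rs :: real.
    balanced u1 u2 \<and> (\<forall>v1 v2. balanced v1 v2 \<longrightarrow> v1 = u1 \<and> v2 = u2) \<and>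
    Rs = hbin (phi (2 * u1)) \<and>
    is_maximum
      {min (hbin (phi (2 * v1)))
         (min (1/2 * hbin (phi (2 * v2))) (1/2 * hbin ((1 - fcomb (2 * v1) (2 * v2)) / 2)))
       | v1 v2. v1 \<in> {0..1/4} \<and> v2 \<in> {0..1/4}} Rs \<and>
    \<bar>u1 - 0.086063\<bar> < 1 / 10^6 \<and> \<bar>u2 - 0.218333\<bar> < 1 / 10^6 \<and> \<bar>Rs - 0.45330\<bar> \<le> 1/2 / 10^5 \<and>
    (\<forall>R. (R, R) \<in> capacity_region noisy_adder \<longrightarrow> R \<le> Rs) \<and>
    is_maximum
      {R. \<exists>(pT :: nat pmf) q1 q2. finite (set_pmf pT) \<and> card (set_pmf pT) \<le> 7 \<and>
            rate_constraints noisy_adder pT q1 q2 R} Rs \<and>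
    (\<exists>q1 q2.
       pmf (q1 0) False = phi (2 * u1) \<and> 1 - pmf (q1 1) False = phi (2 * u1) \<and>
       pmf (q2 0) False = phi (2 * u2) \<and> 1 - pmf (q2 1) False = phi (2 * u2) \<and>
       rate_constraints noisy_adder (pmf_of_set {0, 1 :: nat}) q1 q2 Rs)"
proof -
  obtain s1 s2 :: real where s1: "s1 \<in> {95109/1000000..9510953/100000000}" and s2: "s2 \<in> {644093/2000000..6441009/20000000}"
    and h2: "2 * hbin s1 = hbin s2" and hf: "2 * hbin s1 = hbin ((1 - (s1 + s2 - 2 * s1 * s2)) / 2)"
    using balanced_pair_exists by blast
  define f where "f = s1 + s2 - 2 * s1 * s2"
  define u1 u2 R where "u1 = s1 * (1 - s1)" and "u2 = s2 * (1 - s2)" and "R = hbin s1"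
  note hf = hf[folded f_def]
  have s: "0 < s1" "s1 < 1/2" "0 < s2" "s2 < 1/2" using s1 s2 by auto
  then have smem: "s1 \<in> {0..1/2}" "s2 \<in> {0..1/2}" by auto
  have phi: "phi (2 * u1) = s1" "phi (2 * u2) = s2"
    unfolding u1_def u2_def by (rule phi_param[OF smem(1)], rule phi_param[OF smem(2)])
  have f3: "1/3 \<le> f"
  proof -
    have "95109/1000000 + 644093/2000000 - 2 * (95109/1000000) * (644093/2000000) \<le> f"
      unfolding f_def using s1 s2 by (intro conv_mono) auto
    then show ?thesis by simp
  qed
  have f2: "f \<le> 1/2" unfolding f_def by (rule conv_bounds) (use s in auto)
  have f: "0 < f" "f < 1" using f2 f3 by auto
  have R: "0 \<le> R" unfolding R_def using s by (intro hbin_nonneg) auto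
  obtain c1 c2 where c: "0 \<le> c1" "0 \<le> c2"
    and lagr: "\<And>a b. a \<in> {0..1} \<Longrightarrow> b \<in> {0..1} \<Longrightarrow> cross f a b + c1 * (hbin a - R) + c2 * (hbin b - 2 * R) \<le> 2 * R"
    using lagrange[OF s f_def] unfolding R_def h2[symmetric] hf[symmetric] by metis
  have u: "u1 \<in> {0..1/4}" "u2 \<in> {0..1/4}"
    unfolding u1_def u2_def using s mult_one_minus_mono[of s1 "1/2"] mult_one_minus_mono[of s2 "1/2"] by auto
  have fcomb: "fcomb (2 * v1) (2 * v2) = phi (2 * v1) + phi (2 * v2) - 2 * phi (2 * v1) * phi (2 * v2)" for v1 v2
    by (simp add: fcomb_def)
  have fu: "fcomb (2 * u1) (2 * u2) = f" by (simp add: fcomb phi f_def)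
  have unique: "v1 = u1 \<and> v2 = u2" if "balanced v1 v2" for v1 v2
  proof -
    have v: "v1 \<in> {0..1/4}" "v2 \<in> {0..1/4}" using that by (auto simp: balanced_def)
    have "phi (2 * v1) = s1 \<and> phi (2 * v2) = s2"
      using that by (intro balanced_pair_unique[OF s f_def hf h2 phi_bounds(1)[OF v(1)] phi_bounds(1)[OF v(2)] fcomb])
        (auto simp: balanced_def)
    then show ?thesis using phi_bounds(2)[OF v(1)] phi_bounds(2)[OF v(2)] by (simp add: u1_def u2_def)
  qed
  let ?m = "\<lambda>v1 v2. min (hbin (phi (2 * v1)))
         (min (1/2 * hbin (phi (2 * v2))) (1/2 * hbin ((1 - fcomb (2 * v1) (2 * v2)) / 2)))"
  have m_le: "?m v1 v2 \<le> R" if v: "v1 \<in> {0..1/4}" "v2 \<in> {0..1/4}" for v1 v2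
  proof (rule lagrange_le[OF c])
    let ?t1 = "phi (2 * v1)" and ?t2 = "phi (2 * v2)"
    note t = phi_bounds(1)[OF v(1)] phi_bounds(1)[OF v(2)]
    show "cross f ?t1 ?t2 + c1 * (hbin ?t1 - R) + c2 * (hbin ?t2 - 2 * R) \<le> 2 * R"
      using t by (intro lagr) auto
    \<comment> \<open>The third entry of the minimum lies below its tangent \<open>cross f\<close>,
      so weak duality covers this maximum as well.\<close>
    have "0 \<le> fcomb (2 * v1) (2 * v2)" "fcomb (2 * v1) (2 * v2) \<le> 1/2"
      unfolding fcomb by (rule conv_bounds; use t in simp)+
    then have "hbin ((1 - fcomb (2 * v1) (2 * v2)) / 2) \<le> cross f ?t1 ?t2"
      unfolding fcomb using f by (intro hbin_le_cross) auto
    then show "2 * ?m v1 v2 \<le> cross f ?t1 ?t2" by linarith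
  qed linarith+
  have max1: "is_maximum {?m v1 v2 | v1 v2. v1 \<in> {0..1/4} \<and> v2 \<in> {0..1/4}} R"
  proof -
    have "R = ?m u1 u2" unfolding phi fu R_def using h2 hf by simp
    then show ?thesis unfolding is_maximum_def using u m_le by blast
  qed
  have numerics: "\<bar>u1 - 0.086063\<bar> < 1 / 10^6" "\<bar>u2 - 0.218333\<bar> < 1 / 10^6" "\<bar>R - 0.45330\<bar> \<le> 1/2 / 10^5"
  proof -
    have "95109/1000000 * (1 - 95109/1000000) \<le> u1" "u1 \<le> 9510953/100000000 * (1 - 9510953/100000000)"
      "644093/2000000 * (1 - 644093/2000000) \<le> u2" "u2 \<le> 6441009/20000000 * (1 - 6441009/20000000)"
      unfolding u1_def u2_def using s1 s2 by (intro mult_one_minus_mono; simp)+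
    then have "- (1 / 1000000) < u1 - 0.086063 \<and> u1 - 0.086063 < 1 / 1000000"
      "- (1 / 1000000) < u2 - 0.218333 \<and> u2 - 0.218333 < 1 / 1000000"
      by simp_all
    then show "\<bar>u1 - 0.086063\<bar> < 1 / 10^6" "\<bar>u2 - 0.218333\<bar> < 1 / 10^6"
      unfolding abs_less_iff by auto
    have "hbin (95109/1000000) \<le> R" "R \<le> hbin (9510953/100000000)"
      unfolding R_def using s1 by (auto simp: hbin_le_iff)
    then have "hbin (95109/1000000) * ln 2 \<le> R * ln 2" "R * ln 2 \<le> hbin (9510953/100000000) * ln 2"
      by auto
    \<comment> \<open>Both constants lie within half a unit of the fifth decimal, 1/200000, of
      0.45330.\<close>
    then have "453296/1000000 * ln 2 \<le> R * ln 2" "R * ln 2 \<le> 453304/1000000 * ln 2"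
      using hbin_095109 hbin_09510953 ln_2_bounds unfolding atLeastAtMost_iff by linarith+
    then have "453296/1000000 \<le> R" "R \<le> 453304/1000000" by (simp_all only: mult_le_cancel_right_pos ln_gt_zero one_less_numeral_iff semiring_norm)
    then have "- (1 / 200000) \<le> R - 0.45330 \<and> R - 0.45330 \<le> 1 / 200000" by simp
    then show "\<bar>R - 0.45330\<bar> \<le> 1/2 / 10^5" unfolding abs_le_iff by auto
  qed
  have cap: "R' \<le> R" if "(R', R') \<in> capacity_region noisy_adder" for R'
    using that f R c lagr by (rule capacity_region_le)
  have attained: "rate_constraints noisy_adder (pmf_of_set {0, 1 :: nat}) (flip_law s1) (flip_law s2) R"
    unfolding R_def by (rule rate_constraints_flip[OF s f_def f3 hf h2])
  have max2: "is_maximum {R. \<exists>(pT :: nat pmf) q1 q2. finite (set_pmf pT) \<and> card (set_pmf pT) \<le> 7 \<and>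
            rate_constraints noisy_adder pT q1 q2 R} R"
    unfolding is_maximum_def
  proof safe
    show "\<exists>(pT :: nat pmf) q1 q2. finite (set_pmf pT) \<and> card (set_pmf pT) \<le> 7 \<and> rate_constraints noisy_adder pT q1 q2 R"
      using attained by (intro exI[of _ "pmf_of_set {0, 1 :: nat}"] exI conjI) auto
  next
    fix R' pT q1 q2
    assume "rate_constraints noisy_adder (pT :: nat pmf) q1 q2 R'" "finite (set_pmf pT)"
    then show "R' \<le> R" using f c lagr by (rule rate_constraints_le)
  qed
  have flip: "pmf (flip_law s 0) False = s" "1 - pmf (flip_law s 1) False = s" if "s \<in> {0..1/2}" for s
    using pmf_flip_law[of s] that by auto
  show ?thesis
  proof (intro exI conjI allI impI)
    show "balanced u1 u2"
      using u h2 hf by (simp add: balanced_def phi fu)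
    show "R = hbin (phi (2 * u1))" by (simp add: phi R_def)
    show "v1 = u1" "v2 = u2" if "balanced v1 v2" for v1 v2 using unique[OF that] by auto
    show "rate_constraints noisy_adder (pmf_of_set {0, 1 :: nat}) (flip_law s1) (flip_law s2) R" by (rule attained)
  qed (use max1 max2 numerics cap flip smem phi in auto)
qed

end
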